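(* Let $\mathcal{E},\mathcal{E}'$ be Gaussian exponential sums on $\mathbb{R}^m$ and let $\mathcal{E}\odot\mathcal{E}'$ be their Aronszajn multiplication. For any tuple of independent Gaussian exponential sums $\mathcal{E}_1,\dots,\mathcal{E}_{m-1}$ on $\mathbb{R}^m$ (independent also of $\mathcal{E}$, $\mathcal{E}'$ and $\mathcal{E}\odot\mathcal{E}'$), write $\mathrm{E}:=(\mathcal{E}_1,\dots,\mathcal{E}_{m-1}):\mathbb{R}^m\to\mathbb{R}^{m-1}$. Then, for every open set $U\subset\mathbb{R}^m$, $$\frac{1}{\sqrt2}\Big(\mathbb{E}\#\mathcal{S}\{\mathcal{E},\mathrm{E};U\}+\mathbb{E}\#\mathcal{S}\{\mathcal{E}',\mathrm{E};U\}\Big)\le\mathbb{E}\#\mathcal{S}\{\mathcal{E}\odot\mathcal{E}',\mathrm{E};U\}\le\mathbb{E}\#\mathcal{S}\{\mathcal{E},\mathrm{E};U\}+\mathbb{E}\#\mathcal{S}\{\mathcal{E}',\mathrm{E};U\}.$$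
   Context: A Gaussian exponential sum with finite support $A\subset\mathbb{R}^m$ and coefficients $\alpha=(\alpha_a)_{a\in A}$, $\alpha_a>0$, is the random function $\mathcal{E}_\alpha(x)=\sum_{a\in A}\xi_a\alpha_ae^{\langle a,x\rangle}$ with $\xi_a$ i.i.d. standard real Gaussians. The convex hulls of all supports are assumed to have dimension $m$. Aronszajn multiplication: given finite $A,B\subset\mathbb{R}^m$ and positive coefficients $(\alpha_a)_{a\in A}$, $(\beta_b)_{b\in B}$, $\mathcal{E}_\alpha\odot\mathcal{E}_\beta$ is the Gaussian exponential sum with support the Minkowski sum $C=A+B$ and coefficients $\gamma_c=\sqrt{\sum_{a\in A,\,b\in B,\,a+b=c}\alpha_a^2\beta_b^2}$, $c\in C$ (only its law matters). $\mathcal{S}\{f_1,\dots,f_k;U\}$ is the set of $x\in U$ with $f_1(x)=\dots=f_k(x)=0$ and $\#$ denotes cardinality. *)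

theory Defs
  imports "HOL-Probability.Probability" "HOL-Library.Set_Algebras"
begin

text \<open>A random function on Euclidean space is a map \<^term>\<open>F :: 'w \<Rightarrow> real ^ 'm \<Rightarrow> real\<close> on the
  sample space. The full-dimensionality of the convex hull of the support is part of the
  definition (so the support is in particular nonempty). The values of \<^term>\<open>\<alpha>\<close> outside
  \<^term>\<open>A\<close> are irrelevant.\<close>

definition gaussian_exp_sum ::
    "'w measure \<Rightarrow> (real ^ 'm) set \<Rightarrow> (real ^ 'm \<Rightarrow> real) \<Rightarrow> ('w \<Rightarrow> real ^ 'm \<Rightarrow> real) \<Rightarrow> bool"
  where
  "gaussian_exp_sum M A \<alpha> F \<longleftrightarrow>
     finite A \<and> (\<forall>a\<in>A. \<alpha> a > 0) \<and> aff_dim (convex hull A) = int CARD('m) \<and>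
     (\<exists>\<xi> :: real ^ 'm \<Rightarrow> 'w \<Rightarrow> real.
        prob_space.indep_vars M (\<lambda>_. borel) \<xi> A \<and>
        (\<forall>a\<in>A. distributed M lborel (\<xi> a) (\<lambda>t. ennreal (std_normal_density t))) \<and>
        (\<forall>\<omega>\<in>space M. \<forall>x. F \<omega> x = (\<Sum>a\<in>A. \<xi> a \<omega> * \<alpha> a * exp (a \<bullet> x))))"

definition aronszajn_coeff ::
    "(real ^ 'm) set \<Rightarrow> (real ^ 'm \<Rightarrow> real) \<Rightarrow> (real ^ 'm) set \<Rightarrow> (real ^ 'm \<Rightarrow> real) \<Rightarrow> real ^ 'm \<Rightarrow> real"
  where
  "aronszajn_coeff A \<alpha> B \<beta> c =
     sqrt (\<Sum>(a, b) \<in> {(a, b). a \<in> A \<and> b \<in> B \<and> a + b = c}. (\<alpha> a)\<^sup>2 * (\<beta> b)\<^sup>2)"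

text \<open>The product is determined only up to its law, so it is a predicate on \<^term>\<open>F\<close>:
  any realization with the prescribed support (Minkowski sum) and coefficients.\<close>

definition aronszajn_mult ::
    "'w measure \<Rightarrow> (real ^ 'm) set \<Rightarrow> (real ^ 'm \<Rightarrow> real) \<Rightarrow> (real ^ 'm) set \<Rightarrow> (real ^ 'm \<Rightarrow> real)
      \<Rightarrow> ('w \<Rightarrow> real ^ 'm \<Rightarrow> real) \<Rightarrow> bool"
  where
  "aronszajn_mult M A \<alpha> B \<beta> F \<longleftrightarrow> gaussian_exp_sum M (A + B) (aronszajn_coeff A \<alpha> B \<beta>) F"

text \<open>Mutual independence of random functions, with respect to the sigma-algebra on the function
  space that is generated by all evaluations.\<close>

definition indep_random_functions ::
    "'w measure \<Rightarrow> 'i set \<Rightarrow> ('i \<Rightarrow> 'w \<Rightarrow> real ^ 'm \<Rightarrow> real) \<Rightarrow> bool"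
  where
  "indep_random_functions M I F \<longleftrightarrow>
     prob_space.indep_vars M (\<lambda>_. Pi\<^sub>M UNIV (\<lambda>_. borel)) F I"

definition common_zeros ::
    "'i set \<Rightarrow> ('i \<Rightarrow> real ^ 'm \<Rightarrow> real) \<Rightarrow> (real ^ 'm) set \<Rightarrow> (real ^ 'm) set"
  where
  "common_zeros I f U = {x \<in> U. \<forall>i\<in>I. f i x = 0}"

text \<open>The cardinality is taken in \<^typ>\<open>ennreal\<close>, with value infinity for infinite sets.\<close>

definition expected_zeros ::
    "'w measure \<Rightarrow> 'i set \<Rightarrow> ('i \<Rightarrow> 'w \<Rightarrow> real ^ 'm \<Rightarrow> real) \<Rightarrow> (real ^ 'm) set \<Rightarrow> ennreal"
  where
  "expected_zeros M I F U =
     (\<integral>\<^sup>+ \<omega>. emeasure (count_space UNIV) (common_zeros I (\<lambda>i. F i \<omega>) U) \<partial>M)"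

text \<open>The system consisting of one random function followed by a tuple indexed by
  \<open>1, \<dots>, m - 1\<close>: index \<open>0\<close> holds the distinguished function, so that the whole
  system is indexed by \<open>{..<m}\<close>.\<close>

definition adjoin ::
    "('w \<Rightarrow> real ^ 'm \<Rightarrow> real) \<Rightarrow> (nat \<Rightarrow> 'w \<Rightarrow> real ^ 'm \<Rightarrow> real) \<Rightarrow> nat \<Rightarrow> 'w \<Rightarrow> real ^ 'm \<Rightarrow> real"
  where
  "adjoin F Fs = Fs(0 := F)"

end

theory Submission
  imports Defs
begin

text \<open>
  For fixed values of the remaining coefficients, solving the \<open>k\<close>-th equation for the coefficient of
  one chosen exponent \<open>q k\<close> (the pivot) turns the zeros of the system into the preimages of the
  vector of pivot coefficients under a smooth map \<open>T\<close> of \<open>\<real>\<^sup>m\<close>. The area formula for \<open>T\<close> then yields a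
  Kac--Rice formula without any nondegeneracy discussion: the critical points of \<open>T\<close> are
  harmless by Sard's theorem. Conditionally on all equations but one, the Jacobian is a linear
  functional \<open>L\<close> of the Gaussian gradient of that equation, and integrating its coefficients out
  leaves a constant times \<open>sqrt (Var L)\<close>. Here the variance is taken over a random exponent \<open>a\<close> of
  probability proportional to \<open>(\<alpha> a * exp (a \<bullet> x))\<^sup>2\<close>. Aronszajn multiplication replaces this random
  exponent by a sum of two independent ones, so the variances add, and the theorem reduces to
  \<open>(sqrt s + sqrt t) / sqrt 2 \<le> sqrt (s + t) \<le> sqrt s + sqrt t\<close>.
\<close>

section \<open>Measurability of the number of zeros\<close>

text \<open>The comparison becomes pointwise because the integrals for the three systems differ in a
  single factor: once its coefficients have been integrated out, the distinguished equation is
  visible only through \<open>exp_var\<close> of its support and coefficients, evaluated at a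
  functional built from the other equations. Three obstacles shape the rest. Splitting off the
  pivots by Fubini needs the number of zeros, a possibly infinite count over an uncountable set, to
  be measurable in the coefficients. The hypotheses speak of independent random functions, whereas
  the joint law of all coefficients is wanted; linear independence of exponentials makes each
  coefficient a measurable function of its exponential sum. Finally, the pivot breaks the symmetry
  between exponents. Symmetry returns because the Gaussian density of the pivot contributes exactly
  the missing weight of \<open>q k\<close> to the normalization, and because a variance does not see
  the shift of all exponents by \<open>e (q k)\<close>. The factor 1 / sqrt 2 is Cauchy-Schwarz for
  two terms, with equality when the two variances agree.\<close>

abbreviation ncard :: "'a set \<Rightarrow> ennreal" where
  "ncard X \<equiv> emeasure (count_space UNIV) X"

text \<open>Closed balls with rational radii and centres in a countable dense set suffice. Such a
  family reduces counting the points of a set to asking, for countably many compact sets, whether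
  they are hit.\<close>

lemma countable_separating_compacts:
  fixes U :: "'a::euclidean_space set"
  assumes "open U"
  obtains \<K> where "countable \<K>" "\<And>K. K \<in> \<K> \<Longrightarrow> compact K \<and> K \<subseteq> U"
    "\<And>X. X \<subseteq> U \<Longrightarrow> finite X \<Longrightarrow>
       \<exists>f. f ` X \<subseteq> \<K> \<and> (\<forall>x\<in>X. x \<in> f x) \<and> (\<forall>x\<in>X. \<forall>y\<in>X. x \<noteq> y \<longrightarrow> f x \<inter> f y = {})"
proof -
  obtain D :: "'a set" where D: "countable D" "UNIV \<subseteq> closure D"
    by (rule separable[of UNIV])
  define \<K> where "\<K> = {K \<in> (\<lambda>(q, r). cball q r) ` (D \<times> \<rat>). K \<subseteq> U}"
  have "countable \<K>"
    unfolding \<K>_def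
    by (rule countable_subset[of _ "(\<lambda>(q, r). cball q r) ` (D \<times> \<rat>)"]) (use D(1) countable_rat in auto)
  moreover have "compact K \<and> K \<subseteq> U" if "K \<in> \<K>" for K
    using that by (auto simp: \<K>_def)
  moreover have "\<exists>f. f ` X \<subseteq> \<K> \<and> (\<forall>x\<in>X. x \<in> f x) \<and> (\<forall>x\<in>X. \<forall>y\<in>X. x \<noteq> y \<longrightarrow> f x \<inter> f y = {})"
    if X: "X \<subseteq> U" "finite X" for X
  proof -
    \<comment> \<open>Since \<open>e x\<close> is at most the distance from x to every other point
      of X, balls of half these radii are pairwise disjoint.\<close>
    have "\<forall>x\<in>X. \<exists>e>0. ball x e \<subseteq> U \<and> (\<forall>y\<in>X. y \<noteq> x \<longrightarrow> e \<le> dist x y)"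
    proof
      fix x assume "x \<in> X"
      obtain d where d: "d > 0" "\<forall>y\<in>X. y \<noteq> x \<longrightarrow> d \<le> dist x y"
        using finite_set_avoid[OF X(2), of x] by blast
      obtain d' where d': "d' > 0" "ball x d' \<subseteq> U"
        using openE[OF assms, of x] X \<open>x \<in> X\<close> by blast
      show "\<exists>e>0. ball x e \<subseteq> U \<and> (\<forall>y\<in>X. y \<noteq> x \<longrightarrow> e \<le> dist x y)"
        using d d' by (intro exI[of _ "min d d'"]) (auto simp: subset_iff)
    qed
    then obtain e where e: "\<And>x. x \<in> X \<Longrightarrow> e x > 0" "\<And>x. x \<in> X \<Longrightarrow> ball x (e x) \<subseteq> U"
        "\<And>x y. x \<in> X \<Longrightarrow> y \<in> X \<Longrightarrow> y \<noteq> x \<Longrightarrow> e x \<le> dist x y"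
      by (auto dest!: bchoice)
    have "\<forall>x\<in>X. \<exists>K. K \<in> \<K> \<and> x \<in> K \<and> K \<subseteq> ball x (e x / 2)"
    proof
      fix x assume xX: "x \<in> X"
      \<comment> \<open>A centre within r of x puts \<open>cball q r\<close> into the ball of radius
        2 * r around x; the bound \<open>e x / 4\<close> makes this radius smaller than
        \<open>e x / 2\<close>.\<close>
      obtain r where r: "r \<in> \<rat>" "0 < r" "r < e x / 4"
        using Rats_dense_in_real[of 0 "e x / 4"] e(1)[OF xX] by auto
      have "x \<in> closure D" using D(2) by blast
      then obtain q where q: "q \<in> D" "dist q x < r"
        using r(2) unfolding closure_approachable by blast
      have sub: "cball q r \<subseteq> ball x (e x / 2)"
      proof
        fix z assume "z \<in> cball q r"
        then show "z \<in> ball x (e x / 2)"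
          using q(2) r dist_triangle[of x z q] by (simp add: dist_commute)
      qed
      also have "\<dots> \<subseteq> U"
        using e(1,2)[OF xX] by (force simp: subset_iff)
      finally have "cball q r \<in> \<K>"
        using q(1) r(1) by (auto simp: \<K>_def)
      then show "\<exists>K. K \<in> \<K> \<and> x \<in> K \<and> K \<subseteq> ball x (e x / 2)"
        using sub q(2) by (intro exI[of _ "cball q r"]) auto
    qed
    then obtain f where f: "\<And>x. x \<in> X \<Longrightarrow> f x \<in> \<K> \<and> x \<in> f x \<and> f x \<subseteq> ball x (e x / 2)"
      by (auto dest!: bchoice)
    have "f x \<inter> f y = {}" if "x \<in> X" "y \<in> X" "x \<noteq> y" for x y
    proof -
      have False if "z \<in> f x" "z \<in> f y" for z
      proof -
        have "dist x z < e x / 2" "dist y z < e y / 2"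
          using f[OF \<open>x \<in> X\<close>] f[OF \<open>y \<in> X\<close>] that by auto
        then show False
          using e(3)[of x y] e(3)[of y x] \<open>x \<in> X\<close> \<open>y \<in> X\<close> \<open>x \<noteq> y\<close> dist_triangle2[of x y z]
          by (auto simp: dist_commute)
      qed
      then show ?thesis by blast
    qed
    then show ?thesis
      using f by (intro exI[of _ f]) auto
  qed
  ultimately show ?thesis by (rule that)
qed

lemma ncard_leI:
  assumes "\<And>X. X \<subseteq> Z \<Longrightarrow> finite X \<Longrightarrow> of_nat (card X) \<le> c"
  shows "ncard Z \<le> c"
proof (cases "finite Z")
  case True
  then show ?thesis using assms[of Z] by simp
next
  case False
  have le: "of_nat n \<le> c" for n
  proof -
    obtain X where "finite X" "card X = n" "X \<subseteq> Z"
      using infinite_arbitrarily_large[OF False, of n] by blast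
    then show ?thesis using assms[of X] by simp
  qed
  have "c = \<top>"
  proof (rule ccontr)
    assume "c \<noteq> \<top>"
    then have "c < \<top>" by (simp add: less_top)
    then obtain n where "c < of_nat n" using ennreal_Ex_less_of_nat by blast
    with le[of n] show False by (simp add: leD)
  qed
  then show ?thesis by simp
qed

text \<open>A finite set of points of Z is separated by disjoint members of \<open>\<K>\<close>,
  each of them hit by Z, so its size is bounded by one of the sums. Conversely, choosing a point of
  Z in every hit member of a disjoint family produces distinct points.\<close>

lemma ncard_eq_SUP:
  assumes Z: "Z \<subseteq> U"
    and sep: "\<And>X. X \<subseteq> U \<Longrightarrow> finite X \<Longrightarrow>
       \<exists>f. f ` X \<subseteq> \<K> \<and> (\<forall>x\<in>X. x \<in> f x) \<and> (\<forall>x\<in>X. \<forall>y\<in>X. x \<noteq> y \<longrightarrow> f x \<inter> f y = {})"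
  shows "ncard Z = (SUP \<D> \<in> {\<D>. finite \<D> \<and> \<D> \<subseteq> \<K> \<and> disjoint \<D>}.
           \<Sum>K\<in>\<D>. if \<exists>x\<in>K. x \<in> Z then 1 else 0)" (is "_ = (SUP \<D> \<in> ?I. ?s \<D>)")
proof (rule antisym)
  show "ncard Z \<le> (SUP \<D> \<in> ?I. ?s \<D>)"
  proof (rule ncard_leI)
    fix X assume X: "X \<subseteq> Z" "finite X"
    have "X \<subseteq> U" using X Z by simp
    then obtain f where f: "f ` X \<subseteq> \<K>" "\<forall>x\<in>X. x \<in> f x" "\<forall>x\<in>X. \<forall>y\<in>X. x \<noteq> y \<longrightarrow> f x \<inter> f y = {}"
      using sep[OF _ X(2)] by (elim exE conjE meta_impE)
    have inj: "inj_on f X"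
      using f(2,3) by (fastforce simp: inj_on_def)
    have "?s (f ` X) = (\<Sum>x\<in>X. if \<exists>y\<in>f x. y \<in> Z then 1 else 0)"
      by (simp add: sum.reindex[OF inj])
    also have "\<dots> = (\<Sum>x\<in>X. 1)"
      using f(2) X(1) by (intro sum.cong) auto
    finally have "of_nat (card X) = ?s (f ` X)"
      by simp
    also have "\<dots> \<le> (SUP \<D> \<in> ?I. ?s \<D>)"
    proof (rule SUP_upper)
      have "disjoint (f ` X)"
        using f(3) unfolding pairwise_image by (auto simp: pairwise_def disjnt_def)
      then show "f ` X \<in> ?I"
        using f(1) X(2) by simp
    qed
    finally show "of_nat (card X) \<le> (SUP \<D> \<in> ?I. ?s \<D>)" .
  qed
next
  show "(SUP \<D> \<in> ?I. ?s \<D>) \<le> ncard Z"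
  proof (rule SUP_least)
    fix \<D> assume D: "\<D> \<in> ?I"
    define \<D>' where "\<D>' = {K\<in>\<D>. \<exists>x\<in>K. x \<in> Z}"
    have "\<forall>K\<in>\<D>'. \<exists>x. x \<in> K \<and> x \<in> Z"
      by (auto simp: \<D>'_def)
    then obtain g where g: "\<And>K. K \<in> \<D>' \<Longrightarrow> g K \<in> K \<and> g K \<in> Z"
      by metis
    have "inj_on g \<D>'"
    proof (rule inj_onI)
      fix K L assume *: "K \<in> \<D>'" "L \<in> \<D>'" "g K = g L"
      then have "g K \<in> K \<inter> L" using g by (metis IntI)
      with * D show "K = L" by (auto simp: \<D>'_def disjoint_def)
    qed
    then have "card (g ` \<D>') = card \<D>'"
      by (rule card_image)
    moreover have fin: "finite \<D>'" using D by (auto simp: \<D>'_def)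
    moreover have "?s \<D> = of_nat (card \<D>')"
      using D by (simp add: \<D>'_def sum.If_cases Int_def)
    ultimately have "?s \<D> = ncard (g ` \<D>')"
      by simp
    also have "\<dots> \<le> ncard Z"
      using g by (intro emeasure_mono) auto
    finally show "?s \<D> \<le> ncard Z" .
  qed
qed

text \<open>The uncountable quantifier over K becomes countable: by continuity a zero forces
  arbitrarily small values on a dense subset, and by compactness the absolute value attains its
  infimum, so arbitrarily small values force a zero.\<close>

lemma pred_zero_in_compact:
  fixes g :: "'w \<Rightarrow> 'a::euclidean_space \<Rightarrow> real"
  assumes meas: "\<And>x. x \<in> K \<Longrightarrow> (\<lambda>\<omega>. g \<omega> x) \<in> borel_measurable M"
    and cont: "\<And>\<omega>. \<omega> \<in> space M \<Longrightarrow> continuous_on K (g \<omega>)"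
    and K: "compact K"
  shows "Measurable.pred M (\<lambda>\<omega>. \<exists>x\<in>K. g \<omega> x = 0)"
proof -
  obtain D where D: "countable D" "D \<subseteq> K" "K \<subseteq> closure D"
    by (rule separable)
  have "(\<exists>x\<in>K. g \<omega> x = 0) \<longleftrightarrow> (\<forall>n::nat. \<exists>q\<in>D. \<bar>g \<omega> q\<bar> < 1 / Suc n)" if \<omega>: "\<omega> \<in> space M" for \<omega>
  proof (intro iffI allI)
    fix n :: nat
    assume "\<exists>x\<in>K. g \<omega> x = 0"
    then obtain x where x: "x \<in> K" "g \<omega> x = 0" by blast
    have "1 / real (Suc n) > 0" by simp
    from cont[OF \<omega>, unfolded continuous_on_iff, rule_format, OF x(1) this]
    obtain d where d: "d > 0" "\<And>y. y \<in> K \<Longrightarrow> dist y x < d \<Longrightarrow> dist (g \<omega> y) (g \<omega> x) < 1 / Suc n"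
      by auto
    have "x \<in> closure D" using D(3) x(1) by blast
    then obtain q where "q \<in> D" "dist q x < d"
      using d(1) unfolding closure_approachable by blast
    then show "\<exists>q\<in>D. \<bar>g \<omega> q\<bar> < 1 / Suc n"
      using d(2)[of q] D(2) x(2) by (auto simp: dist_real_def)
  next
    assume *: "\<forall>n::nat. \<exists>q\<in>D. \<bar>g \<omega> q\<bar> < 1 / Suc n"
    then have "K \<noteq> {}" using D(2) by blast
    then obtain x where x: "x \<in> K" "\<And>y. y \<in> K \<Longrightarrow> \<bar>g \<omega> x\<bar> \<le> \<bar>g \<omega> y\<bar>"
      using continuous_attains_inf[OF K _ continuous_on_rabs[OF cont[OF \<omega>]]] by blast
    have "\<bar>g \<omega> x\<bar> \<le> 1 / Suc n" for n
    proof -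
      obtain q where "q \<in> D" "\<bar>g \<omega> q\<bar> < 1 / Suc n"
        using * by blast
      then show ?thesis
        using x(2)[of q] D(2) by auto
    qed
    moreover have "\<exists>n. 1 / Suc n < \<bar>g \<omega> x\<bar>" if "g \<omega> x \<noteq> 0"
      using reals_Archimedean[of "\<bar>g \<omega> x\<bar>"] that by (simp add: inverse_eq_divide)
    ultimately have "g \<omega> x = 0" by (metis linorder_not_less)
    then show "\<exists>x\<in>K. g \<omega> x = 0" using x(1) by blast
  qed
  moreover have "{\<omega>\<in>space M. \<exists>q\<in>D. \<bar>g \<omega> q\<bar> < 1 / Suc n} \<in> sets M" for n
  proof (rule sets.sets_Collect_countable_Ex'[OF _ D(1)])
    fix q assume "q \<in> D"
    then have [measurable]: "(\<lambda>\<omega>. g \<omega> q) \<in> borel_measurable M"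
      using meas D(2) by blast
    show "{\<omega>\<in>space M. \<bar>g \<omega> q\<bar> < 1 / Suc n} \<in> sets M" by measurable
  qed
  ultimately show ?thesis
    by (simp add: pred_def sets.sets_Collect_countable_All cong: conj_cong)
qed

lemma borel_measurable_ncard_zeros:
  fixes g :: "'w \<Rightarrow> 'a::euclidean_space \<Rightarrow> real"
  assumes meas: "\<And>x. x \<in> U \<Longrightarrow> (\<lambda>\<omega>. g \<omega> x) \<in> borel_measurable M"
    and cont: "\<And>\<omega>. \<omega> \<in> space M \<Longrightarrow> continuous_on U (g \<omega>)"
    and U: "open U"
  shows "(\<lambda>\<omega>. ncard {x\<in>U. g \<omega> x = 0}) \<in> borel_measurable M"
proof -
  obtain \<K> where \<K>: "countable \<K>" "\<And>K. K \<in> \<K> \<Longrightarrow> compact K \<and> K \<subseteq> U"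
    and sep: "\<And>X. X \<subseteq> U \<Longrightarrow> finite X \<Longrightarrow>
       \<exists>f. f ` X \<subseteq> \<K> \<and> (\<forall>x\<in>X. x \<in> f x) \<and> (\<forall>x\<in>X. \<forall>y\<in>X. x \<noteq> y \<longrightarrow> f x \<inter> f y = {})"
    by (rule countable_separating_compacts[OF U]) blast
  have eq: "(\<exists>x\<in>K. x \<in> {x\<in>U. g \<omega> x = 0}) = (\<exists>x\<in>K. g \<omega> x = 0)" if "K \<in> \<K>" for K \<omega>
    using \<K>(2)[OF that] by blast
  have meas': "Measurable.pred M (\<lambda>\<omega>. \<exists>x\<in>K. x \<in> {x\<in>U. g \<omega> x = 0})" if K: "K \<in> \<K>" for K
    unfolding eq[OF that]
  proof (rule pred_zero_in_compact)
    show "(\<lambda>\<omega>. g \<omega> x) \<in> borel_measurable M" if "x \<in> K" for x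
      using \<K>(2)[OF K] that by (auto intro: meas)
    show "continuous_on K (g \<omega>)" if "\<omega> \<in> space M" for \<omega>
      using \<K>(2)[OF K] that by (auto intro: cont[THEN continuous_on_subset])
    show "compact K" using \<K>(2)[OF K] by simp
  qed
  have count: "countable {\<D>. finite \<D> \<and> \<D> \<subseteq> \<K> \<and> disjoint \<D>}"
    using countable_Collect_finite_subset[OF \<K>(1)] by (rule countable_subset[rotated]) auto
  have "ncard {x\<in>U. g \<omega> x = 0} = (SUP \<D> \<in> {\<D>. finite \<D> \<and> \<D> \<subseteq> \<K> \<and> disjoint \<D>}.
           \<Sum>K\<in>\<D>. if \<exists>x\<in>K. x \<in> {x\<in>U. g \<omega> x = 0} then 1 else 0)" for \<omega>
    by (rule ncard_eq_SUP[OF _ sep]) auto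
  moreover have "(\<lambda>\<omega>. SUP \<D> \<in> {\<D>. finite \<D> \<and> \<D> \<subseteq> \<K> \<and> disjoint \<D>}.
           \<Sum>K\<in>\<D>. if \<exists>x\<in>K. x \<in> {x\<in>U. g \<omega> x = 0} then 1 else (0::ennreal)) \<in> borel_measurable M"
  proof (rule borel_measurable_SUP[OF count], rule borel_measurable_sum)
    fix \<D> K assume "\<D> \<in> {\<D>. finite \<D> \<and> \<D> \<subseteq> \<K> \<and> disjoint \<D>}" "K \<in> \<D>"
    then have [measurable]: "Measurable.pred M (\<lambda>\<omega>. \<exists>x\<in>K. x \<in> {x\<in>U. g \<omega> x = 0})"
      by (intro meas') blast
    show "(\<lambda>\<omega>. if \<exists>x\<in>K. x \<in> {x\<in>U. g \<omega> x = 0} then 1 else (0::ennreal)) \<in> borel_measurable M"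
      by measurable
  qed
  ultimately show ?thesis by (simp only:)
qed

section \<open>The area formula\<close>

text \<open>The change-of-variables theorem for signed, absolutely integrable functions, recast for
  nonnegative extended integrals. Measurability of the image is obtained with respect to the
  completion only.\<close>

lemma area_formula_inj_on:
  fixes T :: "real^'n::{finite,wellorder} \<Rightarrow> real^'n::_"
  assumes S: "S \<in> sets lebesgue"
    and der: "\<And>x. x \<in> S \<Longrightarrow> (T has_derivative (*v) (A x)) (at x)"
    and inj: "inj_on T S"
    and \<phi>: "integrable lborel \<phi>" "\<And>z. 0 \<le> \<phi> z"
  shows "T ` S \<in> sets lebesgue"
    and "(\<integral>\<^sup>+z. ennreal (\<phi> z) * indicator (T ` S) z \<partial>lborel) =
      (\<integral>\<^sup>+x. ennreal (\<bar>det (A x)\<bar> * \<phi> (T x)) * indicator S x \<partial>lborel)"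
proof -
  have der': "(T has_derivative (*v) (A x)) (at x within S)" if "x \<in> S" for x
    using der[OF that] by (rule has_derivative_at_withinI)
  show TS: "T ` S \<in> sets lebesgue"
    by (rule differentiable_image_in_sets_lebesgue[OF S])
       (use der' in \<open>auto simp: differentiable_def differentiable_on_def\<close>)
  have "integrable lebesgue \<phi>"
    using \<phi>(1) by (subst integrable_completion) auto
  then have "\<phi> absolutely_integrable_on UNIV"
    by (simp add: set_integrable_def)
  then have ai: "\<phi> absolutely_integrable_on T ` S"
    by (rule set_integrable_subset[OF _ TS]) simp
  define b where "b = integral (T ` S) \<phi>"
  \<comment> \<open>The change-of-variables theorem is about vector-valued integrands, so the scalar
    \<phi> is read as a map into \<open>real^1\<close> through \<open>vec\<close>.\<close>
  have "(\<lambda>x. \<bar>det (matrix ((*v) (A x)))\<bar> *\<^sub>R (vec (\<phi> (T x)) :: real^1)) absolutely_integrable_on S \<and>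
      integral S (\<lambda>x. \<bar>det (matrix ((*v) (A x)))\<bar> *\<^sub>R (vec (\<phi> (T x)) :: real^1)) = vec b"
    by (rule has_absolute_integral_change_of_variables[OF S der' inj, THEN iffD2])
       (use ai in \<open>auto simp: absolutely_integrable_on_1_iff integral_on_1_eq b_def\<close>)
  then have "(\<lambda>x. \<bar>det (A x)\<bar> * \<phi> (T x)) absolutely_integrable_on S"
      "integral S (\<lambda>x. \<bar>det (A x)\<bar> * \<phi> (T x)) = b"
    by (auto simp: absolutely_integrable_on_1_iff integral_on_1_eq vec_eq_iff)
  then have "((\<lambda>x. \<bar>det (A x)\<bar> * \<phi> (T x)) has_integral b) S"
    using set_lebesgue_integral_eq_integral(1) by (auto simp: has_integral_iff)
  moreover have "(\<phi> has_integral b) (T ` S)"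
    using set_lebesgue_integral_eq_integral(1)[OF ai] by (auto simp: has_integral_iff b_def)
  ultimately show "(\<integral>\<^sup>+z. ennreal (\<phi> z) * indicator (T ` S) z \<partial>lborel) =
      (\<integral>\<^sup>+x. ennreal (\<bar>det (A x)\<bar> * \<phi> (T x)) * indicator S x \<partial>lborel)"
    using \<phi>(2) by (simp add: nn_integral_has_integral_lebesgue')
qed

text \<open>The injectivity half of the inverse function theorem. It asks for a left inverse of the
  derivative at a and for continuity of the derivative in operator norm, which is deduced here from
  continuity of the entries.\<close>

lemma locally_injective_of_det_nonzero:
  fixes T :: "real^'n \<Rightarrow> real^'n"
  assumes der: "\<And>x. (T has_derivative (*v) (A x)) (at x)"
    and cont: "\<And>i j. continuous_on UNIV (\<lambda>x. A x $ i $ j)"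
    and a: "det (A a) \<noteq> 0" "a \<in> V" "open V"
  obtains r where "r > 0" "ball a r \<subseteq> V" "inj_on T (ball a r)"
proof -
  obtain B where B: "B ** A a = mat 1"
    using a(1) invertible_det_nz[of "A a"] unfolding invertible_def by blast
  \<comment> \<open>\<open>h x\<close> dominates the operator norm of \<open>A x - A a\<close> and
    vanishes at a.\<close>
  define h where "h x = (\<Sum>i\<in>UNIV. \<Sum>j\<in>UNIV. \<bar>A x $ i $ j - A a $ i $ j\<bar>)" for x
  have h: "continuous_on UNIV h"
    unfolding h_def by (intro continuous_intros cont)
  have "\<exists>d>0. \<forall>x. dist a x < d \<longrightarrow> onorm (\<lambda>v. A x *v v - A a *v v) < e" if "e > 0" for e
  proof -
    from h[unfolded continuous_on_iff, rule_format, OF UNIV_I that, of a]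
    obtain d where d: "d > 0" "\<And>x. dist x a < d \<Longrightarrow> dist (h x) (h a) < e"
      by auto
    have "onorm (\<lambda>v. A x *v v - A a *v v) < e" if "dist a x < d" for x
    proof -
      have "(\<lambda>v. A x *v v - A a *v v) = (*v) (A x - A a)"
        by (simp add: fun_eq_iff matrix_vector_mult_diff_rdistrib)
      then have "onorm (\<lambda>v. A x *v v - A a *v v) = onorm ((*v) (A x - A a))"
        by (simp only:)
      also have "\<dots> \<le> h x"
        using onorm_le_matrix_component_sum[of "A x - A a"] by (simp add: h_def)
      also have "\<dots> < e"
        using d(2)[of x] that by (simp add: h_def dist_commute dist_real_def)
      finally show ?thesis .
    qed
    with d(1) show ?thesis by blast
  qed
  moreover have "(*v) B \<circ> (*v) (A a) = id"
    by (simp add: fun_eq_iff matrix_vector_mul_assoc B)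
  ultimately show ?thesis
    using has_derivative_locally_injective[OF a(2,3), of "(*v) B" "\<lambda>x. (*v) (A x)" T]
      der matrix_vector_mul_bounded_linear that by blast
qed

text \<open>Where the Jacobian is nonzero, T is locally injective, and the Lindelof property leaves
  countably many pieces to sum over. The remaining points contribute to neither side: their values
  form a null set, and on the right the determinant is zero.\<close>

lemma area_formula:
  fixes T :: "real^'n::{finite,wellorder} \<Rightarrow> real^'n::_"
  assumes U: "open U"
    and der: "\<And>x. (T has_derivative (*v) (A x)) (at x)"
    and cont: "\<And>i j. continuous_on UNIV (\<lambda>x. A x $ i $ j)"
    and \<phi>: "integrable lborel \<phi>" "\<And>z. 0 \<le> \<phi> z"
  shows "(\<integral>\<^sup>+z. ennreal (\<phi> z) * ncard {x\<in>U. T x = z} \<partial>lborel) =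
      (\<integral>\<^sup>+x. ennreal (\<bar>det (A x)\<bar> * \<phi> (T x)) * indicator U x \<partial>lborel)"
proof -
  have cont_det: "continuous_on UNIV (\<lambda>x. det (A x))"
    unfolding det_def by (intro continuous_intros cont)
  have cont_T: "continuous_on UNIV T"
    by (rule has_derivative_continuous_on) (rule has_derivative_at_withinI[OF der])
  define V where "V = U \<inter> (\<lambda>x. det (A x)) -` (- {0})"
  have V: "open V"
    unfolding V_def using U cont_det by (intro open_Int open_vimage) auto
  define \<F> where "\<F> = {W. open W \<and> W \<subseteq> V \<and> inj_on T W}"
  have "V \<subseteq> \<Union>\<F>"
  proof
    fix a assume a: "a \<in> V"
    then have "det (A a) \<noteq> 0" by (simp add: V_def)
    then obtain r where "r > 0" "ball a r \<subseteq> V" "inj_on T (ball a r)"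
      by (rule locally_injective_of_det_nonzero[OF der cont _ a V])
    then show "a \<in> \<Union>\<F>"
      by (intro UnionI[of "ball a r"]) (auto simp: \<F>_def)
  qed
  then have UF: "\<Union>\<F> = V" by (auto simp: \<F>_def)
  obtain \<F>' where F': "\<F>' \<subseteq> \<F>" "countable \<F>'" "\<Union>\<F>' = \<Union>\<F>"
    by (rule Lindelof[of \<F>]) (auto simp: \<F>_def)
  \<comment> \<open>Adding the empty set makes the family nonempty, so that it can be enumerated by
    all natural numbers even if V is empty.\<close>
  define W where "W = from_nat_into (insert {} \<F>')"
  have range_W: "range W = insert {} \<F>'"
    unfolding W_def using F'(2) by (intro range_from_nat_into) auto
  then have WF: "W n \<in> insert {} \<F>" for n
    using F'(1) by blast
  have W: "open (W n)" "inj_on T (W n)" for n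
    using WF[of n] by (auto simp: \<F>_def)
  have UW: "(\<Union>n. W n) = V"
    using range_W F'(3) UF by auto
  define D where "D = disjointed W"
  have "range W \<subseteq> sets borel"
    using W(1) by auto
  then have D_borel: "D n \<in> sets borel" for n
    unfolding D_def using sets.range_disjointed_sets[of W borel] by blast
  have D_inj: "inj_on T (D n)" for n
    unfolding D_def using W(2) by (rule inj_on_subset) (rule disjointed_subset)
  have UD: "(\<Union>n. D n) = V"
    unfolding D_def UN_disjointed_eq UW ..
  have disj: "disjoint_family D"
    unfolding D_def by (rule disjoint_family_disjointed)
  have rank: "rank (matrix ((*v) (A x))) < CARD('n)" if "x \<in> U - V" for x
  proof -
    have "\<not> invertible (A x)"
      using that by (simp add: V_def invertible_det_nz)
    then have "\<not> inj ((*v) (A x))"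
      using matrix_left_invertible_injective[of "A x"] invertible_left_inverse[of "A x"] by blast
    then show ?thesis
      by (simp add: less_rank_noninjective)
  qed
  have "negligible (T ` (U - V))"
    by (rule baby_Sard[OF _ has_derivative_at_withinI[OF der] rank]) auto
  then have ae: "AE z in lebesgue. z \<notin> T ` (U - V)"
    by (intro AE_not_in) (simp add: negligible_iff_null_sets)
  have count: "ncard {x\<in>U. T x = z} = (\<Sum>n. indicator (T ` D n) z)" if z: "z \<notin> T ` (U - V)" for z
  proof -
    have "{x\<in>U. T x = z} = (\<Union>n. {x\<in>D n. T x = z})"
      using z UD by (auto simp: V_def)
    also have "ncard \<dots> = (\<Sum>n. ncard {x\<in>D n. T x = z})"
      using disj by (intro suminf_emeasure[symmetric]) (auto simp: disjoint_family_on_def)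
    also have "\<dots> = (\<Sum>n. indicator (T ` D n) z)"
    proof (rule suminf_cong)
      fix n
      show "ncard {x\<in>D n. T x = z} = indicator (T ` D n) z"
      proof (cases "z \<in> T ` D n")
        case True
        then obtain x where x: "x \<in> D n" "T x = z" by auto
        then have "{x\<in>D n. T x = z} = {x}"
          using D_inj[of n] by (auto simp: inj_on_def)
        then show ?thesis using True by simp
      next
        case False
        then have "{x\<in>D n. T x = z} = {}" by auto
        then show ?thesis using False by (metis emeasure_empty indicator_simps(2))
      qed
    qed
    finally show ?thesis .
  qed
  have \<phi>_meas[measurable]: "\<phi> \<in> borel_measurable borel"
    using borel_measurable_integrable[OF \<phi>(1)] by simp
  have T_meas[measurable]: "T \<in> borel_measurable borel"
    by (rule borel_measurable_continuous_onI[OF cont_T])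
  have det_meas[measurable]: "(\<lambda>x. det (A x)) \<in> borel_measurable borel"
    by (rule borel_measurable_continuous_onI[OF cont_det])
  \<comment> \<open>The images of the pieces are known to be Lebesgue, not Borel, measurable. The
    computation therefore starts and ends in \<open>lborel\<close>, but the sum is exchanged with
    the integral over the completion.\<close>
  have D_leb: "D n \<in> sets lebesgue" for n using D_borel by simp
  note inj_formula = area_formula_inj_on[OF D_leb der D_inj \<phi>]
  have "(\<integral>\<^sup>+z. ennreal (\<phi> z) * ncard {x\<in>U. T x = z} \<partial>lborel) =
      (\<integral>\<^sup>+z. ennreal (\<phi> z) * ncard {x\<in>U. T x = z} \<partial>lebesgue)"
    by (rule nn_integral_completion[symmetric])
  also have "\<dots> = (\<integral>\<^sup>+z. (\<Sum>n. ennreal (\<phi> z) * indicator (T ` D n) z) \<partial>lebesgue)"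
    using ae by (intro nn_integral_cong_AE, eventually_elim) (simp add: count)
  also have "\<dots> = (\<Sum>n. \<integral>\<^sup>+z. ennreal (\<phi> z) * indicator (T ` D n) z \<partial>lebesgue)"
  proof (rule nn_integral_suminf)
    fix n
    have [measurable]: "T ` D n \<in> sets lebesgue" by (rule inj_formula(1))
    have [measurable]: "\<phi> \<in> borel_measurable lebesgue"
      using \<phi>_meas by (intro measurable_completion) simp
    show "(\<lambda>z. ennreal (\<phi> z) * indicator (T ` D n) z) \<in> borel_measurable lebesgue"
      by measurable
  qed
  also have "\<dots> = (\<Sum>n. \<integral>\<^sup>+x. ennreal (\<bar>det (A x)\<bar> * \<phi> (T x)) * indicator (D n) x \<partial>lborel)"
    by (simp add: nn_integral_completion inj_formula(2))
  also have "\<dots> = (\<integral>\<^sup>+x. (\<Sum>n. ennreal (\<bar>det (A x)\<bar> * \<phi> (T x)) * indicator (D n) x) \<partial>lborel)"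
    using D_borel by (intro nn_integral_suminf[symmetric]) simp
  also have "\<dots> = (\<integral>\<^sup>+x. ennreal (\<bar>det (A x)\<bar> * \<phi> (T x)) * indicator U x \<partial>lborel)"
  proof (rule nn_integral_cong)
    fix x
    have "(\<Sum>n. indicator (D n) x :: ennreal) = indicator V x"
      using suminf_indicator[OF disj, of x] UD by simp
    then show "(\<Sum>n. ennreal (\<bar>det (A x)\<bar> * \<phi> (T x)) * indicator (D n) x) =
        ennreal (\<bar>det (A x)\<bar> * \<phi> (T x)) * indicator U x"
      by (auto simp: V_def split: split_indicator)
  qed
  finally show ?thesis .
qed

section \<open>Gaussian integrals\<close>

definition std_gauss :: "real measure" where
  "std_gauss = density lborel (\<lambda>t. ennreal (std_normal_density t))"

lemma sets_std_gauss[measurable_cong, simp]: "sets std_gauss = sets borel"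
  by (simp add: std_gauss_def)

lemma space_std_gauss[simp]: "space std_gauss = UNIV"
  by (simp add: std_gauss_def)

lemma prob_space_std_gauss: "prob_space std_gauss"
  unfolding std_gauss_def by (rule prob_space_normal_density) simp

lemma sigma_finite_std_gauss: "sigma_finite_measure std_gauss"
  by (rule prob_space_imp_sigma_finite[OF prob_space_std_gauss])

lemma product_sigma_finite_std_gauss: "product_sigma_finite (\<lambda>_. std_gauss)"
  by (simp add: product_sigma_finite_def sigma_finite_std_gauss)

lemma pair_sigma_finite_std_gauss: "pair_sigma_finite std_gauss std_gauss"
  by (simp add: pair_sigma_finite_def sigma_finite_std_gauss)

lemma nn_integral_std_gauss:
  assumes [measurable]: "f \<in> borel_measurable borel"
  shows "(\<integral>\<^sup>+x. f x \<partial>std_gauss) = (\<integral>\<^sup>+x. ennreal (std_normal_density x) * f x \<partial>lborel)"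
  unfolding std_gauss_def by (simp add: nn_integral_density)

text \<open>The rotation is factored into affine substitutions in one variable. If c is nonzero,
  replacing x at fixed y, and y at fixed new first coordinate, produces the factors 1 / |c| and |c|,
  which cancel. If c = 0, only a swap and reflections are left.\<close>

lemma nn_integral_lborel_rotation:
  fixes g :: "real \<Rightarrow> real \<Rightarrow> ennreal"
  assumes g[measurable]: "case_prod g \<in> borel_measurable (borel \<Otimes>\<^sub>M borel)"
    and cs: "c\<^sup>2 + s\<^sup>2 = (1::real)"
  shows "(\<integral>\<^sup>+x. \<integral>\<^sup>+y. g (c * x + s * y) (c * y - s * x) \<partial>lborel \<partial>lborel) = (\<integral>\<^sup>+x. \<integral>\<^sup>+y. g x y \<partial>lborel \<partial>lborel)"
proof -
  have Fub: "(\<integral>\<^sup>+x. \<integral>\<^sup>+y. f x y \<partial>lborel \<partial>lborel) = (\<integral>\<^sup>+y. \<integral>\<^sup>+x. f x y \<partial>lborel \<partial>lborel)"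
    if [measurable]: "case_prod f \<in> borel_measurable (borel \<Otimes>\<^sub>M borel)" for f :: "real \<Rightarrow> real \<Rightarrow> ennreal"
    using lborel_pair.Fubini'[of f] that by simp
  have m: "(\<lambda>x. g (a x) (b x)) \<in> borel_measurable M"
    if [measurable]: "a \<in> borel_measurable M" "b \<in> borel_measurable M" for a b :: "'z \<Rightarrow> real" and M
    using measurable_compose[OF measurable_Pair[OF that] g] by simp
  have gy: "(\<lambda>y. g u y) \<in> borel_measurable borel" for u
    by (rule m) simp_all
  show ?thesis
  proof (cases "c = 0")
    case False
    have "(\<integral>\<^sup>+x. \<integral>\<^sup>+y. g (c * x + s * y) (c * y - s * x) \<partial>lborel \<partial>lborel) =
        (\<integral>\<^sup>+y. \<integral>\<^sup>+x. g (c * x + s * y) (c * y - s * x) \<partial>lborel \<partial>lborel)"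
      by (rule Fub) (unfold case_prod_beta, rule m, measurable)
    \<comment> \<open>Here u = c * x + s * y, and c^2 + s^2 = 1 yields c * y - s * x = (y - s * u) /
      c.\<close>
    also have "\<dots> = (\<integral>\<^sup>+y. ennreal (1 / \<bar>c\<bar>) * (\<integral>\<^sup>+u. g u ((y - s * u) / c) \<partial>lborel) \<partial>lborel)"
    proof (rule nn_integral_cong)
      fix y
      have "(\<integral>\<^sup>+u. g u ((y - s * u) / c) \<partial>lborel) =
          ennreal \<bar>c\<bar> * (\<integral>\<^sup>+x. g (s * y + c * x) ((y - s * (s * y + c * x)) / c) \<partial>lborel)"
        by (rule nn_integral_real_affine[OF _ False]) (rule m, measurable)
      also have "(\<lambda>x. g (s * y + c * x) ((y - s * (s * y + c * x)) / c)) = (\<lambda>x. g (c * x + s * y) (c * y - s * x))"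
      proof
        fix x
        have "y - s * (s * y + c * x) = (c\<^sup>2 + s\<^sup>2) * y - s * (s * y + c * x)"
          using cs by simp
        also have "\<dots> = c * (c * y - s * x)"
          by (simp add: power2_eq_square algebra_simps)
        finally show "g (s * y + c * x) ((y - s * (s * y + c * x)) / c) = g (c * x + s * y) (c * y - s * x)"
          using False by (simp add: add.commute)
      qed
      finally show "(\<integral>\<^sup>+x. g (c * x + s * y) (c * y - s * x) \<partial>lborel) =
          ennreal (1 / \<bar>c\<bar>) * (\<integral>\<^sup>+u. g u ((y - s * u) / c) \<partial>lborel)"
        using False by (simp add: mult.assoc[symmetric] ennreal_mult[symmetric])
    qed
    also have "\<dots> = ennreal (1 / \<bar>c\<bar>) * (\<integral>\<^sup>+y. \<integral>\<^sup>+u. g u ((y - s * u) / c) \<partial>lborel \<partial>lborel)"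
    proof (rule nn_integral_cmult)
      have [measurable]: "(\<lambda>(y, u). g u ((y - s * u) / c)) \<in> borel_measurable (borel \<Otimes>\<^sub>M borel)"
        by (unfold case_prod_beta, rule m, measurable)
      show "(\<lambda>y. \<integral>\<^sup>+u. g u ((y - s * u) / c) \<partial>lborel) \<in> borel_measurable lborel"
        by simp measurable
    qed
    also have "(\<integral>\<^sup>+y. \<integral>\<^sup>+u. g u ((y - s * u) / c) \<partial>lborel \<partial>lborel) =
        (\<integral>\<^sup>+u. \<integral>\<^sup>+y. g u ((y - s * u) / c) \<partial>lborel \<partial>lborel)"
      by (rule Fub) (unfold case_prod_beta, rule m, measurable)
    also have "\<dots> = (\<integral>\<^sup>+u. ennreal \<bar>c\<bar> * (\<integral>\<^sup>+v. g u v \<partial>lborel) \<partial>lborel)"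
    proof (rule nn_integral_cong)
      fix u
      have "(\<integral>\<^sup>+v. g u v \<partial>lborel) = ennreal \<bar>1 / c\<bar> * (\<integral>\<^sup>+y. g u (- (s * u / c) + 1 / c * y) \<partial>lborel)"
        by (rule nn_integral_real_affine[OF gy]) (use False in simp)
      also have "(\<lambda>y. g u (- (s * u / c) + 1 / c * y)) = (\<lambda>y. g u ((y - s * u) / c))"
        by (simp add: diff_divide_distrib)
      finally show "(\<integral>\<^sup>+y. g u ((y - s * u) / c) \<partial>lborel) = ennreal \<bar>c\<bar> * (\<integral>\<^sup>+v. g u v \<partial>lborel)"
        using False by (simp add: mult.assoc[symmetric] ennreal_mult[symmetric])
    qed
    also have "\<dots> = ennreal \<bar>c\<bar> * (\<integral>\<^sup>+u. \<integral>\<^sup>+v. g u v \<partial>lborel \<partial>lborel)"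
      by (rule nn_integral_cmult) measurable
    finally show ?thesis
      using False by (simp add: mult.assoc[symmetric] ennreal_mult[symmetric])
  next
    case True
    then have s: "\<bar>s\<bar> = 1" "s \<noteq> 0"
      using cs by (auto simp: power2_eq_1_iff)
    have "(\<integral>\<^sup>+x. \<integral>\<^sup>+y. g x y \<partial>lborel \<partial>lborel) = (\<integral>\<^sup>+x. \<integral>\<^sup>+y. g (s * x) y \<partial>lborel \<partial>lborel)"
    proof -
      have [measurable]: "(\<lambda>x. \<integral>\<^sup>+y. g x y \<partial>lborel) \<in> borel_measurable borel"
        by measurable
      have "(\<integral>\<^sup>+x. \<integral>\<^sup>+y. g x y \<partial>lborel \<partial>lborel) = ennreal \<bar>s\<bar> * (\<integral>\<^sup>+x. \<integral>\<^sup>+y. g (0 + s * x) y \<partial>lborel \<partial>lborel)"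
        by (rule nn_integral_real_affine[OF _ s(2)]) measurable
      then show ?thesis using s(1) by simp
    qed
    also have "\<dots> = (\<integral>\<^sup>+x. \<integral>\<^sup>+y. g (s * x) (- (s * y)) \<partial>lborel \<partial>lborel)"
    proof (rule nn_integral_cong)
      fix x
      have "(\<integral>\<^sup>+y. g (s * x) y \<partial>lborel) = ennreal \<bar>- s\<bar> * (\<integral>\<^sup>+y. g (s * x) (0 + - s * y) \<partial>lborel)"
        by (rule nn_integral_real_affine[OF gy]) (use s(2) in simp)
      then show "(\<integral>\<^sup>+y. g (s * x) y \<partial>lborel) = (\<integral>\<^sup>+y. g (s * x) (- (s * y)) \<partial>lborel)"
        using s(1) by simp
    qed
    also have "\<dots> = (\<integral>\<^sup>+y. \<integral>\<^sup>+x. g (s * x) (- (s * y)) \<partial>lborel \<partial>lborel)"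
      by (rule Fub) (unfold case_prod_beta, rule m, measurable)
    finally show ?thesis
      using True by simp
  qed
qed

text \<open>The product density depends only on x^2 + y^2.\<close>

lemma nn_integral_std_gauss_rotation:
  fixes h :: "real \<Rightarrow> real \<Rightarrow> ennreal"
  assumes h[measurable]: "case_prod h \<in> borel_measurable (borel \<Otimes>\<^sub>M borel)"
    and cs: "c\<^sup>2 + s\<^sup>2 = (1::real)"
  shows "(\<integral>\<^sup>+x. \<integral>\<^sup>+y. h (c * x + s * y) (c * y - s * x) \<partial>std_gauss \<partial>std_gauss) =
    (\<integral>\<^sup>+x. \<integral>\<^sup>+y. h x y \<partial>std_gauss \<partial>std_gauss)"
proof -
  let ?\<phi> = "\<lambda>x. ennreal (std_normal_density x)"
  have *: "(\<integral>\<^sup>+x. \<integral>\<^sup>+y. f x y \<partial>std_gauss \<partial>std_gauss) = (\<integral>\<^sup>+x. \<integral>\<^sup>+y. ?\<phi> x * ?\<phi> y * f x y \<partial>lborel \<partial>lborel)"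
    if [measurable]: "case_prod f \<in> borel_measurable (borel \<Otimes>\<^sub>M borel)" for f :: "real \<Rightarrow> real \<Rightarrow> ennreal"
    by (simp add: nn_integral_std_gauss nn_integral_cmult[symmetric] mult.assoc)
  have [measurable]: "(\<lambda>x. h (a x) (b x)) \<in> borel_measurable M"
    if [measurable]: "a \<in> borel_measurable M" "b \<in> borel_measurable M" for a b :: "'z \<Rightarrow> real" and M
    using measurable_compose[OF measurable_Pair[OF that] h] by simp
  have inv: "?\<phi> x * ?\<phi> y = ?\<phi> (c * x + s * y) * ?\<phi> (c * y - s * x)" for x y
  proof -
    have "(c * x + s * y)\<^sup>2 + (c * y - s * x)\<^sup>2 = (c\<^sup>2 + s\<^sup>2) * (x\<^sup>2 + y\<^sup>2)"
      by (simp add: power2_eq_square algebra_simps)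
    then have "exp (- x\<^sup>2 / 2) * exp (- y\<^sup>2 / 2) = exp (- (c * x + s * y)\<^sup>2 / 2) * exp (- (c * y - s * x)\<^sup>2 / 2)"
      unfolding exp_add[symmetric] using cs by (simp add: field_simps)
    then show ?thesis
      by (simp add: ennreal_mult[symmetric] std_normal_density_def)
  qed
  let ?g = "\<lambda>x y. ?\<phi> x * ?\<phi> y * h x y"
  have "(\<integral>\<^sup>+x. \<integral>\<^sup>+y. h (c * x + s * y) (c * y - s * x) \<partial>std_gauss \<partial>std_gauss) =
      (\<integral>\<^sup>+x. \<integral>\<^sup>+y. ?\<phi> x * ?\<phi> y * h (c * x + s * y) (c * y - s * x) \<partial>lborel \<partial>lborel)"
    by (rule *) measurable
  also have "\<dots> = (\<integral>\<^sup>+x. \<integral>\<^sup>+y. ?g (c * x + s * y) (c * y - s * x) \<partial>lborel \<partial>lborel)"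
    by (intro nn_integral_cong, subst inv, rule refl)
  also have "\<dots> = (\<integral>\<^sup>+x. \<integral>\<^sup>+y. ?g x y \<partial>lborel \<partial>lborel)"
    by (rule nn_integral_lborel_rotation[OF _ cs]) measurable
  also have "\<dots> = (\<integral>\<^sup>+x. \<integral>\<^sup>+y. h x y \<partial>std_gauss \<partial>std_gauss)"
    by (rule *[symmetric]) measurable
  finally show ?thesis .
qed

text \<open>Stability of the Gaussian law: rotate the pair so that the first coordinate points along
  (a, b); the second coordinate then integrates to 1. If a = b = 0, any rotation will do.\<close>

lemma nn_integral_std_gauss_combine:
  fixes k :: "real \<Rightarrow> ennreal"
  assumes [measurable]: "k \<in> borel_measurable borel"
  shows "(\<integral>\<^sup>+x. \<integral>\<^sup>+y. k (a * x + b * y) \<partial>std_gauss \<partial>std_gauss) = (\<integral>\<^sup>+x. k (sqrt (a\<^sup>2 + b\<^sup>2) * x) \<partial>std_gauss)"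
proof -
  interpret prob_space std_gauss by (rule prob_space_std_gauss)
  define r where "r = sqrt (a\<^sup>2 + b\<^sup>2)"
  have "\<exists>c s. c\<^sup>2 + s\<^sup>2 = 1 \<and> a = r * c \<and> b = r * s"
  proof (cases "r = 0")
    case True
    then have "a\<^sup>2 + b\<^sup>2 = 0" by (simp add: r_def)
    then have "a = 0" "b = 0" by (auto simp: add_nonneg_eq_0_iff)
    then show ?thesis using True by (intro exI[of _ 1] exI[of _ 0]) simp
  next
    case False
    have "r\<^sup>2 = a\<^sup>2 + b\<^sup>2" by (simp add: r_def)
    then show ?thesis
      using False by (intro exI[of _ "a / r"] exI[of _ "b / r"])
        (auto simp: power_divide add_divide_distrib[symmetric])
  qed
  then obtain c s where cs: "c\<^sup>2 + s\<^sup>2 = 1" and ab: "a = r * c" "b = r * s" by blast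
  have "(\<integral>\<^sup>+x. \<integral>\<^sup>+y. k (r * (c * x + s * y)) \<partial>std_gauss \<partial>std_gauss) = (\<integral>\<^sup>+x. \<integral>\<^sup>+y. k (r * x) \<partial>std_gauss \<partial>std_gauss)"
    using nn_integral_std_gauss_rotation[of "\<lambda>x y. k (r * x)", OF _ cs] by simp
  then show ?thesis
    unfolding r_def[symmetric] using emeasure_space_1 by (simp add: ab algebra_simps)
qed

text \<open>The triple is a Cholesky factor of the Gram matrix of u and v: two Gaussian functionals
  of arbitrarily many variables are realized by a triangular map of two variables. The induction
  adds a variable r; a rotation of (q, r) restores the triangular shape, and the leftover multiple
  of r merges with the p-term.\<close>

lemma gaussian_linear_pair:
  fixes u v :: "'i \<Rightarrow> real"
  assumes "finite I"
  shows "\<exists>\<alpha> \<beta> \<gamma>. \<alpha>\<^sup>2 + \<beta>\<^sup>2 = (\<Sum>i\<in>I. (u i)\<^sup>2) \<and> \<beta> * \<gamma> = (\<Sum>i\<in>I. u i * v i) \<and> \<gamma>\<^sup>2 = (\<Sum>i\<in>I. (v i)\<^sup>2) \<and>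
    (\<forall>h. case_prod h \<in> borel_measurable (borel \<Otimes>\<^sub>M borel) \<longrightarrow>
      (\<integral>\<^sup>+\<eta>. h (\<Sum>i\<in>I. \<eta> i * u i) (\<Sum>i\<in>I. \<eta> i * v i) \<partial>PiM I (\<lambda>_. std_gauss)) =
      (\<integral>\<^sup>+p. \<integral>\<^sup>+q. h (\<alpha> * p + \<beta> * q) (\<gamma> * q) \<partial>std_gauss \<partial>std_gauss))"
  using assms
proof (induction I rule: finite_induct)
  case empty
  interpret product_sigma_finite "\<lambda>_. std_gauss" by (rule product_sigma_finite_std_gauss)
  interpret prob_space std_gauss by (rule prob_space_std_gauss)
  interpret E: prob_space "Pi\<^sub>M ({} :: 'i set) (\<lambda>_. std_gauss)"
    by (rule prob_space_PiM) (rule prob_space_std_gauss)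
  show ?case
    using emeasure_space_1 E.emeasure_space_1
    by (intro exI[of _ 0]) (simp add: nn_integral_empty)
next
  case (insert i I)
  interpret product_sigma_finite "\<lambda>_. std_gauss" by (rule product_sigma_finite_std_gauss)
  interpret pair_sigma_finite std_gauss std_gauss by (rule pair_sigma_finite_std_gauss)
  obtain \<alpha> \<beta> \<gamma> where gram: "\<alpha>\<^sup>2 + \<beta>\<^sup>2 = (\<Sum>i\<in>I. (u i)\<^sup>2)" "\<beta> * \<gamma> = (\<Sum>i\<in>I. u i * v i)" "\<gamma>\<^sup>2 = (\<Sum>i\<in>I. (v i)\<^sup>2)"
    and IH: "\<forall>h. case_prod h \<in> borel_measurable (borel \<Otimes>\<^sub>M borel) \<longrightarrow>
      (\<integral>\<^sup>+\<eta>. h (\<Sum>i\<in>I. \<eta> i * u i) (\<Sum>i\<in>I. \<eta> i * v i) \<partial>PiM I (\<lambda>_. std_gauss)) =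
      (\<integral>\<^sup>+p. \<integral>\<^sup>+q. h (\<alpha> * p + \<beta> * q) (\<gamma> * q) \<partial>std_gauss \<partial>std_gauss)"
    using insert.IH by (elim exE conjE)
  define \<delta> \<epsilon> where "\<delta> = u i" and "\<epsilon> = v i"
  define \<gamma>' where "\<gamma>' = sqrt (\<gamma>\<^sup>2 + \<epsilon>\<^sup>2)"
  \<comment> \<open>The rotation sends the row (\<gamma>, \<epsilon>) of the second functional to
    (\<gamma>', 0); when both entries vanish, the identity rotation serves.\<close>
  have "\<exists>c s. c\<^sup>2 + s\<^sup>2 = 1 \<and> \<gamma> = \<gamma>' * c \<and> \<epsilon> = \<gamma>' * s"
  proof (cases "\<gamma>' = 0")
    case True
    then have "\<gamma>\<^sup>2 + \<epsilon>\<^sup>2 = 0" by (simp add: \<gamma>'_def)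
    then have "\<gamma> = 0" "\<epsilon> = 0" by (auto simp: add_nonneg_eq_0_iff)
    then show ?thesis using True by (intro exI[of _ 1] exI[of _ 0]) simp
  next
    case False
    have "\<gamma>'\<^sup>2 = \<gamma>\<^sup>2 + \<epsilon>\<^sup>2" by (simp add: \<gamma>'_def)
    then show ?thesis
      using False by (intro exI[of _ "\<gamma> / \<gamma>'"] exI[of _ "\<epsilon> / \<gamma>'"])
        (auto simp: power_divide add_divide_distrib[symmetric])
  qed
  moreover have \<gamma>': "\<gamma>'\<^sup>2 = \<gamma>\<^sup>2 + \<epsilon>\<^sup>2" by (simp add: \<gamma>'_def)
  ultimately obtain c s where cs: "c\<^sup>2 + s\<^sup>2 = 1" and \<gamma>\<epsilon>: "\<gamma> = \<gamma>' * c" "\<epsilon> = \<gamma>' * s" by blast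
  \<comment> \<open>(\<beta>', \<delta>') is the row of the first functional in the rotated
    coordinates; \<alpha>' below absorbs \<delta>' into the independent p-term by stability.\<close>
  define \<beta>' \<delta>' where "\<beta>' = \<beta> * c + \<delta> * s" and "\<delta>' = \<delta> * c - \<beta> * s"
  define \<alpha>' where "\<alpha>' = sqrt (\<alpha>\<^sup>2 + \<delta>'\<^sup>2)"
  have \<beta>\<delta>: "\<beta> = \<beta>' * c - \<delta>' * s" "\<delta> = \<beta>' * s + \<delta>' * c"
  proof -
    have "\<beta>' * c - \<delta>' * s = \<beta> * (c\<^sup>2 + s\<^sup>2)" "\<beta>' * s + \<delta>' * c = \<delta> * (c\<^sup>2 + s\<^sup>2)"
      by (simp_all add: \<beta>'_def \<delta>'_def power2_eq_square algebra_simps)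
    then show "\<beta> = \<beta>' * c - \<delta>' * s" "\<delta> = \<beta>' * s + \<delta>' * c" using cs by simp_all
  qed
  have "\<beta>'\<^sup>2 + \<delta>'\<^sup>2 = (\<beta>\<^sup>2 + \<delta>\<^sup>2) * (c\<^sup>2 + s\<^sup>2)"
    by (simp add: \<beta>'_def \<delta>'_def power2_eq_square algebra_simps)
  then have g1: "\<alpha>'\<^sup>2 + \<beta>'\<^sup>2 = (\<Sum>i\<in>insert i I. (u i)\<^sup>2)"
    using insert.hyps gram(1) cs by (simp add: \<alpha>'_def \<delta>_def)
  have "\<beta>' * \<gamma>' = \<beta> * \<gamma> + \<delta> * \<epsilon>"
    by (simp add: \<beta>'_def \<gamma>\<epsilon> algebra_simps)
  then have g2: "\<beta>' * \<gamma>' = (\<Sum>i\<in>insert i I. u i * v i)"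
    using insert.hyps gram(2) by (simp add: \<delta>_def \<epsilon>_def)
  have g3: "\<gamma>'\<^sup>2 = (\<Sum>i\<in>insert i I. (v i)\<^sup>2)"
    using insert.hyps gram(3) \<gamma>' by (simp add: \<epsilon>_def)
  have "(\<integral>\<^sup>+\<eta>. h (\<Sum>j\<in>insert i I. \<eta> j * u j) (\<Sum>j\<in>insert i I. \<eta> j * v j) \<partial>PiM (insert i I) (\<lambda>_. std_gauss)) =
      (\<integral>\<^sup>+p. \<integral>\<^sup>+q. h (\<alpha>' * p + \<beta>' * q) (\<gamma>' * q) \<partial>std_gauss \<partial>std_gauss)"
    if h[measurable]: "case_prod h \<in> borel_measurable (borel \<Otimes>\<^sub>M borel)" for h :: "real \<Rightarrow> real \<Rightarrow> ennreal"
  proof -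
    have m[measurable (raw)]: "(\<lambda>x. h (a x) (b x)) \<in> borel_measurable M"
      if [measurable]: "a \<in> borel_measurable M" "b \<in> borel_measurable M" for a b :: "'z \<Rightarrow> real" and M
      using measurable_compose[OF measurable_Pair[OF that] h] by simp
    have upd: "(\<Sum>j\<in>insert i I. (\<eta>(i := r)) j * w j) = r * w i + (\<Sum>j\<in>I. \<eta> j * w j)" for \<eta> r and w :: "'i \<Rightarrow> real"
    proof -
      have "(\<Sum>j\<in>I. (\<eta>(i := r)) j * w j) = (\<Sum>j\<in>I. \<eta> j * w j)"
        using insert.hyps by (intro sum.cong) auto
      then show ?thesis using insert.hyps by simp
    qed
    have "(\<integral>\<^sup>+\<eta>. h (\<Sum>j\<in>insert i I. \<eta> j * u j) (\<Sum>j\<in>insert i I. \<eta> j * v j) \<partial>PiM (insert i I) (\<lambda>_. std_gauss)) =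
        (\<integral>\<^sup>+r. \<integral>\<^sup>+\<eta>. h (\<Sum>j\<in>insert i I. (\<eta>(i := r)) j * u j) (\<Sum>j\<in>insert i I. (\<eta>(i := r)) j * v j)
          \<partial>PiM I (\<lambda>_. std_gauss) \<partial>std_gauss)"
      by (rule product_nn_integral_insert_rev[OF insert.hyps]) measurable
    also have "\<dots> = (\<integral>\<^sup>+r. \<integral>\<^sup>+\<eta>. h (r * \<delta> + (\<Sum>j\<in>I. \<eta> j * u j)) (r * \<epsilon> + (\<Sum>j\<in>I. \<eta> j * v j))
          \<partial>PiM I (\<lambda>_. std_gauss) \<partial>std_gauss)"
      by (simp only: upd \<delta>_def \<epsilon>_def)
    also have "\<dots> = (\<integral>\<^sup>+r. \<integral>\<^sup>+p. \<integral>\<^sup>+q. h (r * \<delta> + (\<alpha> * p + \<beta> * q)) (r * \<epsilon> + \<gamma> * q) \<partial>std_gauss \<partial>std_gauss \<partial>std_gauss)"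
    proof (rule nn_integral_cong)
      fix r :: real
      have "case_prod (\<lambda>x y. h (r * \<delta> + x) (r * \<epsilon> + y)) \<in> borel_measurable (borel \<Otimes>\<^sub>M borel)"
        by measurable
      from IH[rule_format, OF this]
      show "(\<integral>\<^sup>+\<eta>. h (r * \<delta> + (\<Sum>j\<in>I. \<eta> j * u j)) (r * \<epsilon> + (\<Sum>j\<in>I. \<eta> j * v j)) \<partial>PiM I (\<lambda>_. std_gauss)) =
        (\<integral>\<^sup>+p. \<integral>\<^sup>+q. h (r * \<delta> + (\<alpha> * p + \<beta> * q)) (r * \<epsilon> + \<gamma> * q) \<partial>std_gauss \<partial>std_gauss)" .
    qed
    also have "\<dots> = (\<integral>\<^sup>+p. \<integral>\<^sup>+r. \<integral>\<^sup>+q. h (r * \<delta> + (\<alpha> * p + \<beta> * q)) (r * \<epsilon> + \<gamma> * q) \<partial>std_gauss \<partial>std_gauss \<partial>std_gauss)"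
      by (rule Fubini') measurable
    also have "\<dots> = (\<integral>\<^sup>+p. \<integral>\<^sup>+q. \<integral>\<^sup>+r. h (r * \<delta> + (\<alpha> * p + \<beta> * q)) (r * \<epsilon> + \<gamma> * q) \<partial>std_gauss \<partial>std_gauss \<partial>std_gauss)"
      by (intro nn_integral_cong Fubini') measurable
    also have "\<dots> = (\<integral>\<^sup>+p. \<integral>\<^sup>+q. \<integral>\<^sup>+r. h (\<alpha> * p + \<beta>' * q + \<delta>' * r) (\<gamma>' * q) \<partial>std_gauss \<partial>std_gauss \<partial>std_gauss)"
    proof (rule nn_integral_cong)
      fix p :: real
      have "r * \<delta> + (\<alpha> * p + \<beta> * q) = \<alpha> * p + \<beta>' * (c * q + s * r) + \<delta>' * (c * r - s * q)"
          "r * \<epsilon> + \<gamma> * q = \<gamma>' * (c * q + s * r)" for q r :: real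
        unfolding \<beta>\<delta> \<gamma>\<epsilon> by (simp_all add: algebra_simps)
      then show "(\<integral>\<^sup>+q. \<integral>\<^sup>+r. h (r * \<delta> + (\<alpha> * p + \<beta> * q)) (r * \<epsilon> + \<gamma> * q) \<partial>std_gauss \<partial>std_gauss) =
          (\<integral>\<^sup>+q. \<integral>\<^sup>+r. h (\<alpha> * p + \<beta>' * q + \<delta>' * r) (\<gamma>' * q) \<partial>std_gauss \<partial>std_gauss)"
        using nn_integral_std_gauss_rotation[OF _ cs, of "\<lambda>q r. h (\<alpha> * p + \<beta>' * q + \<delta>' * r) (\<gamma>' * q)"]
        by (simp only:) measurable
    qed
    also have "\<dots> = (\<integral>\<^sup>+q. \<integral>\<^sup>+p. \<integral>\<^sup>+r. h (\<alpha> * p + \<beta>' * q + \<delta>' * r) (\<gamma>' * q) \<partial>std_gauss \<partial>std_gauss \<partial>std_gauss)"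
      by (rule Fubini') measurable
    also have "\<dots> = (\<integral>\<^sup>+q. \<integral>\<^sup>+p. h (\<alpha>' * p + \<beta>' * q) (\<gamma>' * q) \<partial>std_gauss \<partial>std_gauss)"
    proof (rule nn_integral_cong)
      fix q :: real
      have "(\<integral>\<^sup>+p. \<integral>\<^sup>+r. h ((\<alpha> * p + \<delta>' * r) + \<beta>' * q) (\<gamma>' * q) \<partial>std_gauss \<partial>std_gauss) =
          (\<integral>\<^sup>+p. h (sqrt (\<alpha>\<^sup>2 + \<delta>'\<^sup>2) * p + \<beta>' * q) (\<gamma>' * q) \<partial>std_gauss)"
        by (rule nn_integral_std_gauss_combine) measurable
      then show "(\<integral>\<^sup>+p. \<integral>\<^sup>+r. h (\<alpha> * p + \<beta>' * q + \<delta>' * r) (\<gamma>' * q) \<partial>std_gauss \<partial>std_gauss) =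
          (\<integral>\<^sup>+p. h (\<alpha>' * p + \<beta>' * q) (\<gamma>' * q) \<partial>std_gauss)"
        by (simp add: \<alpha>'_def add_ac)
    qed
    also have "\<dots> = (\<integral>\<^sup>+p. \<integral>\<^sup>+q. h (\<alpha>' * p + \<beta>' * q) (\<gamma>' * q) \<partial>std_gauss \<partial>std_gauss)"
      by (rule Fubini') measurable
    finally show ?thesis .
  qed
  with g1 g2 g3 show ?case by blast
qed

text \<open>The standard normal density at 0 times the mean absolute value of a standard Gaussian,
  that is 1 / pi. It is common to all three systems of the comparison.\<close>

definition gauss_abs_const :: ennreal where
  "gauss_abs_const = ennreal (1 / sqrt (2 * pi)) * (\<integral>\<^sup>+p. ennreal \<bar>p\<bar> \<partial>std_gauss)"

text \<open>Completing the square: the product of the densities at q and \<gamma> * q is a centred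
  Gaussian in q of variance 1 / (1 + \<gamma>^2), up to the total mass that stands in front.\<close>

lemma nn_integral_std_gauss_mult_density:
  fixes f :: "real \<Rightarrow> ennreal"
  assumes [measurable]: "f \<in> borel_measurable borel"
  shows "(\<integral>\<^sup>+q. f q * ennreal (std_normal_density (\<gamma> * q)) \<partial>std_gauss) =
    ennreal (1 / (sqrt (2 * pi) * sqrt (1 + \<gamma>\<^sup>2))) * (\<integral>\<^sup>+q. f (q / sqrt (1 + \<gamma>\<^sup>2)) \<partial>std_gauss)"
proof -
  define w where "w = sqrt (1 + \<gamma>\<^sup>2)"
  have w: "w > 0" "w\<^sup>2 = 1 + \<gamma>\<^sup>2"
    unfolding w_def by (auto intro: add_pos_nonneg)
  have dens: "std_normal_density (q / w) * std_normal_density (\<gamma> * (q / w)) = 1 / sqrt (2 * pi) * std_normal_density q" for q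
  proof -
    have "(q / w)\<^sup>2 + (\<gamma> * (q / w))\<^sup>2 = (1 + \<gamma>\<^sup>2) * q\<^sup>2 / w\<^sup>2"
      by (simp add: power_mult_distrib power_divide add_divide_distrib algebra_simps)
    also have "\<dots> = q\<^sup>2"
      using w by (simp flip: w(2))
    finally have "exp (- (q / w)\<^sup>2 / 2) * exp (- (\<gamma> * (q / w))\<^sup>2 / 2) = exp (- q\<^sup>2 / 2)"
      unfolding exp_add[symmetric] by (simp add: field_simps)
    then show ?thesis
      by (simp add: std_normal_density_def)
  qed
  have "(\<integral>\<^sup>+q. f q * ennreal (std_normal_density (\<gamma> * q)) \<partial>std_gauss) =
      (\<integral>\<^sup>+q. ennreal (std_normal_density q) * (f q * ennreal (std_normal_density (\<gamma> * q))) \<partial>lborel)"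
    by (rule nn_integral_std_gauss) measurable
  also have "\<dots> = ennreal \<bar>1 / w\<bar> * (\<integral>\<^sup>+q. ennreal (std_normal_density (0 + 1 / w * q)) *
      (f (0 + 1 / w * q) * ennreal (std_normal_density (\<gamma> * (0 + 1 / w * q)))) \<partial>lborel)"
    by (rule nn_integral_real_affine) (measurable, use w(1) in simp)
  also have "(\<lambda>q. ennreal (std_normal_density (0 + 1 / w * q)) *
      (f (0 + 1 / w * q) * ennreal (std_normal_density (\<gamma> * (0 + 1 / w * q))))) =
      (\<lambda>q. ennreal (1 / sqrt (2 * pi)) * (ennreal (std_normal_density q) * f (q / w)))"
  proof
    fix q
    have "ennreal (std_normal_density (q / w)) * (f (q / w) * ennreal (std_normal_density (\<gamma> * (q / w)))) =
        ennreal (std_normal_density (q / w) * std_normal_density (\<gamma> * (q / w))) * f (q / w)"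
      by (simp add: ennreal_mult mult_ac)
    moreover have "ennreal (1 / sqrt (2 * pi) * std_normal_density q) = ennreal (1 / sqrt (2 * pi)) * ennreal (std_normal_density q)"
      by (rule ennreal_mult) auto
    moreover have "0 + 1 / w * q = q / w" by simp
    ultimately show "ennreal (std_normal_density (0 + 1 / w * q)) *
      (f (0 + 1 / w * q) * ennreal (std_normal_density (\<gamma> * (0 + 1 / w * q)))) =
      ennreal (1 / sqrt (2 * pi)) * (ennreal (std_normal_density q) * f (q / w))"
      unfolding dens by (simp only: mult.assoc)
  qed
  also have "ennreal \<bar>1 / w\<bar> * (\<integral>\<^sup>+q. ennreal (1 / sqrt (2 * pi)) * (ennreal (std_normal_density q) * f (q / w)) \<partial>lborel) =
      ennreal (1 / (sqrt (2 * pi) * w)) * (\<integral>\<^sup>+q. ennreal (std_normal_density q) * f (q / w) \<partial>lborel)"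
    using w(1) by (subst nn_integral_cmult) (simp_all add: mult.assoc[symmetric] ennreal_mult[symmetric] mult.commute)
  also have "(\<integral>\<^sup>+q. ennreal (std_normal_density q) * f (q / w) \<partial>lborel) = (\<integral>\<^sup>+q. f (q / w) \<partial>std_gauss)"
    by (rule nn_integral_std_gauss[symmetric]) measurable
  finally show ?thesis by (simp add: w_def)
qed

text \<open>Write U and V for the two sums and \<zeta> for an independent pivot. The left side is
  the density at 0 of V - \<zeta>, a Gaussian of variance W, times the conditional mean of |U| given
  V = \<zeta>; the conditional variance of U is the usual Schur complement. This explains the 1 in
  W: it is the variance of the pivot.\<close>

lemma nn_integral_gauss_abs_density:
  fixes u v :: "'i \<Rightarrow> real"
  assumes "finite I"
  defines "W \<equiv> 1 + (\<Sum>i\<in>I. (v i)\<^sup>2)"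
  shows "(\<integral>\<^sup>+\<eta>. ennreal \<bar>\<Sum>i\<in>I. \<eta> i * u i\<bar> * ennreal (std_normal_density (\<Sum>i\<in>I. \<eta> i * v i)) \<partial>PiM I (\<lambda>_. std_gauss)) =
    gauss_abs_const * ennreal (sqrt ((\<Sum>i\<in>I. (u i)\<^sup>2) / W - ((\<Sum>i\<in>I. u i * v i) / W)\<^sup>2))"
proof -
  obtain \<alpha> \<beta> \<gamma> where gram: "\<alpha>\<^sup>2 + \<beta>\<^sup>2 = (\<Sum>i\<in>I. (u i)\<^sup>2)" "\<beta> * \<gamma> = (\<Sum>i\<in>I. u i * v i)" "\<gamma>\<^sup>2 = (\<Sum>i\<in>I. (v i)\<^sup>2)"
    and law: "\<forall>h. case_prod h \<in> borel_measurable (borel \<Otimes>\<^sub>M borel) \<longrightarrow>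
      (\<integral>\<^sup>+\<eta>. h (\<Sum>i\<in>I. \<eta> i * u i) (\<Sum>i\<in>I. \<eta> i * v i) \<partial>PiM I (\<lambda>_. std_gauss)) =
      (\<integral>\<^sup>+p. \<integral>\<^sup>+q. h (\<alpha> * p + \<beta> * q) (\<gamma> * q) \<partial>std_gauss \<partial>std_gauss)"
    using gaussian_linear_pair[OF assms(1), of u v] by (elim exE conjE)
  have W: "W = 1 + \<gamma>\<^sup>2" "W > 0"
    by (auto simp: W_def gram(3)[symmetric] intro: add_pos_nonneg)
  let ?r = "sqrt (\<alpha>\<^sup>2 + (\<beta> / sqrt W)\<^sup>2)"
  have "case_prod (\<lambda>x y. ennreal \<bar>x\<bar> * ennreal (std_normal_density y)) \<in> borel_measurable (borel \<Otimes>\<^sub>M borel)"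
    by measurable
  from law[rule_format, OF this]
  have "(\<integral>\<^sup>+\<eta>. ennreal \<bar>\<Sum>i\<in>I. \<eta> i * u i\<bar> * ennreal (std_normal_density (\<Sum>i\<in>I. \<eta> i * v i)) \<partial>PiM I (\<lambda>_. std_gauss)) =
    (\<integral>\<^sup>+p. \<integral>\<^sup>+q. ennreal \<bar>\<alpha> * p + \<beta> * q\<bar> * ennreal (std_normal_density (\<gamma> * q)) \<partial>std_gauss \<partial>std_gauss)" .
  also have "\<dots> = (\<integral>\<^sup>+p. ennreal (1 / (sqrt (2 * pi) * sqrt W)) *
      (\<integral>\<^sup>+q. ennreal \<bar>\<alpha> * p + \<beta> * (q / sqrt W)\<bar> \<partial>std_gauss) \<partial>std_gauss)"
    unfolding W(1) by (intro nn_integral_cong nn_integral_std_gauss_mult_density) measurable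
  also have "\<dots> = ennreal (1 / (sqrt (2 * pi) * sqrt W)) *
      (\<integral>\<^sup>+p. \<integral>\<^sup>+q. ennreal \<bar>\<alpha> * p + \<beta> / sqrt W * q\<bar> \<partial>std_gauss \<partial>std_gauss)"
    by (subst nn_integral_cmult) (auto intro!: sigma_finite_measure.borel_measurable_nn_integral[OF sigma_finite_std_gauss])
  also have "(\<integral>\<^sup>+p. \<integral>\<^sup>+q. ennreal \<bar>\<alpha> * p + \<beta> / sqrt W * q\<bar> \<partial>std_gauss \<partial>std_gauss) =
      (\<integral>\<^sup>+p. ennreal \<bar>?r * p\<bar> \<partial>std_gauss)"
    by (rule nn_integral_std_gauss_combine) measurable
  also have "\<dots> = ennreal ?r * (\<integral>\<^sup>+p. ennreal \<bar>p\<bar> \<partial>std_gauss)"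
    by (subst nn_integral_cmult[symmetric]) (auto simp: abs_mult ennreal_mult)
  also have "ennreal (1 / (sqrt (2 * pi) * sqrt W)) * (ennreal ?r * (\<integral>\<^sup>+p. ennreal \<bar>p\<bar> \<partial>std_gauss)) =
      gauss_abs_const * ennreal (?r / sqrt W)"
    using W(2) by (simp add: gauss_abs_const_def divide_inverse ennreal_mult mult_ac)
  \<comment> \<open>The identity \<gamma>^2 = W - 1 eliminates the Cholesky entries in favour of the
    Gram sums.\<close>
  also have "?r / sqrt W = sqrt ((\<Sum>i\<in>I. (u i)\<^sup>2) / W - ((\<Sum>i\<in>I. u i * v i) / W)\<^sup>2)"
  proof -
    have "(\<alpha>\<^sup>2 + (\<beta> / sqrt W)\<^sup>2) / W = ((\<alpha>\<^sup>2 + \<beta>\<^sup>2) * W - \<beta>\<^sup>2 * (W - 1)) / W\<^sup>2"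
      using W(2) by (simp add: power_divide field_simps power2_eq_square)
    also have "\<dots> = (\<alpha>\<^sup>2 + \<beta>\<^sup>2) / W - (\<beta> * \<gamma> / W)\<^sup>2"
      using W by (simp add: power_divide power_mult_distrib diff_divide_distrib power2_eq_square)
    finally show ?thesis
      unfolding gram by (simp add: real_sqrt_divide[symmetric])
  qed
  finally show ?thesis .
qed

section \<open>The joint law of the coefficients\<close>

text \<open>Each pair of distinct exponents excludes only a hyperplane of directions, and finitely
  many null sets do not fill the space.\<close>

lemma exists_separating_direction:
  fixes A :: "'a::euclidean_space set"
  assumes "finite A"
  shows "\<exists>v. \<forall>a\<in>A. \<forall>b\<in>A. a \<noteq> b \<longrightarrow> a \<bullet> v \<noteq> b \<bullet> v"
proof -
  define N where "N = (\<Union>p\<in>{p\<in>A \<times> A. fst p \<noteq> snd p}. {v. (fst p - snd p) \<bullet> v = 0})"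
  have "negligible N"
    unfolding N_def using assms by (intro negligible_Union) (auto intro!: negligible_hyperplane)
  then have "N \<noteq> UNIV"
    using non_negligible_UNIV by auto
  then obtain v where "v \<notin> N" by blast
  then show ?thesis
    by (intro exI[of _ v]) (auto simp: N_def inner_diff_left)
qed

text \<open>Restricted to the multiples of a direction that separates the exponents, an exponential sum
  becomes a power sum, whose coefficients are extracted by Lagrange interpolation.\<close>

lemma exp_sum_coefficient:
  fixes A :: "'a::euclidean_space set"
  assumes "finite A" "a \<in> A"
  shows "\<exists>n p y. \<forall>c. (\<Sum>i\<le>(n::nat). p i * (\<Sum>b\<in>A. c b * exp (b \<bullet> y i))) = c a"
proof -
  obtain v where v: "\<And>a b. a \<in> A \<Longrightarrow> b \<in> A \<Longrightarrow> a \<noteq> b \<Longrightarrow> a \<bullet> v \<noteq> b \<bullet> v"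
    using exists_separating_direction[OF assms(1)] by blast
  define P where "P = (\<Prod>b\<in>A - {a}. smult (1 / (exp (a \<bullet> v) - exp (b \<bullet> v))) [:- exp (b \<bullet> v), 1:])"
  have P: "poly P (exp (b \<bullet> v)) = (if b = a then 1 else 0)" if b: "b \<in> A" for b
  proof (cases "b = a")
    case True
    have "poly P (exp (a \<bullet> v)) = (\<Prod>b\<in>A - {a}. 1)"
      unfolding P_def poly_prod using v[OF assms(2)] by (intro prod.cong) (auto simp: divide_simps)
    then show ?thesis using True by simp
  next
    case False
    then have "poly P (exp (b \<bullet> v)) = 0"
      unfolding P_def poly_prod using assms(1) b by (intro prod_zero) auto
    then show ?thesis using False by simp
  qed
  have "(\<Sum>i\<le>degree P. coeff P i * (\<Sum>b\<in>A. c b * exp (b \<bullet> (of_nat i *\<^sub>R v)))) = c a" for c :: "'a \<Rightarrow> real"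
  proof -
    have "(\<Sum>i\<le>degree P. coeff P i * (\<Sum>b\<in>A. c b * exp (b \<bullet> (of_nat i *\<^sub>R v)))) =
        (\<Sum>b\<in>A. c b * (\<Sum>i\<le>degree P. coeff P i * exp (b \<bullet> v) ^ i))"
      by (simp add: sum_distrib_left exp_of_nat_mult[symmetric] mult_ac sum.swap[of _ A])
    also have "\<dots> = (\<Sum>b\<in>A. c b * (if b = a then 1 else 0))"
      using P by (intro sum.cong) (auto simp: poly_altdef[symmetric])
    also have "\<dots> = c a"
      using assms by (simp add: if_distrib[of "(*) _"] cong: if_cong)
    finally show ?thesis .
  qed
  then show ?thesis
    by (intro exI[of _ "degree P"] exI[of _ "coeff P"] exI[of _ "\<lambda>i. of_nat i *\<^sub>R v"]) blast
qed

text \<open>Independence is given inside each random function and between the functions, the latter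
  on function space. Each coefficient is a measurable functional of finitely many evaluations of its
  function, so the probability of a box for all coefficients factors over the functions, and each
  factor over the coefficients of one function.\<close>

lemma distr_coefficients_eq_PiM:
  fixes A :: "'k \<Rightarrow> (real ^ 'm) set" and F :: "'k \<Rightarrow> 'w \<Rightarrow> real ^ 'm \<Rightarrow> real"
  assumes M: "prob_space M" and K: "finite K" "K \<noteq> {}"
    and A: "\<And>k. k \<in> K \<Longrightarrow> finite (A k)" "\<And>k. k \<in> K \<Longrightarrow> A k \<noteq> {}"
    and \<alpha>: "\<And>k a. k \<in> K \<Longrightarrow> a \<in> A k \<Longrightarrow> \<alpha> k a > 0"
    and \<xi>_indep: "\<And>k. k \<in> K \<Longrightarrow> prob_space.indep_vars M (\<lambda>_. borel) (\<xi> k) (A k)"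
    and \<xi>_distr: "\<And>k a. k \<in> K \<Longrightarrow> a \<in> A k \<Longrightarrow> distributed M lborel (\<xi> k a) (\<lambda>t. ennreal (std_normal_density t))"
    and F: "\<And>k \<omega> x. k \<in> K \<Longrightarrow> \<omega> \<in> space M \<Longrightarrow> F k \<omega> x = (\<Sum>a\<in>A k. \<xi> k a \<omega> * \<alpha> k a * exp (a \<bullet> x))"
    and F_indep: "prob_space.indep_vars M (\<lambda>_. Pi\<^sub>M UNIV (\<lambda>_. borel)) F K"
  shows "distr M (Pi\<^sub>M (Sigma K A) (\<lambda>_. borel)) (\<lambda>\<omega>. \<lambda>j\<in>Sigma K A. \<xi> (fst j) (snd j) \<omega>) = Pi\<^sub>M (Sigma K A) (\<lambda>_. std_gauss)"
    and "\<And>k a. k \<in> K \<Longrightarrow> a \<in> A k \<Longrightarrow> \<xi> k a \<in> borel_measurable M"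
proof -
  interpret prob_space M by fact
  interpret product_sigma_finite "\<lambda>_. std_gauss" by (rule product_sigma_finite_std_gauss)
  show \<xi>_meas[measurable]: "\<xi> k a \<in> borel_measurable M" if "k \<in> K" "a \<in> A k" for k a
    using distributed_measurable[OF \<xi>_distr[OF that]] by simp
  have fin: "finite (Sigma K A)" using K A by auto
  have "\<forall>j. \<exists>n p y. fst j \<in> K \<and> snd j \<in> A (fst j) \<longrightarrow>
      (\<forall>c. (\<Sum>i\<le>(n::nat). p i * (\<Sum>b\<in>A (fst j). c b * exp (b \<bullet> y i))) = c (snd j))"
  proof
    fix j :: "'k \<times> (real ^ 'm)"
    show "\<exists>n p y. fst j \<in> K \<and> snd j \<in> A (fst j) \<longrightarrow>
      (\<forall>c. (\<Sum>i\<le>(n::nat). p i * (\<Sum>b\<in>A (fst j). c b * exp (b \<bullet> y i))) = c (snd j))"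
    proof (cases "fst j \<in> K \<and> snd j \<in> A (fst j)")
      case True
      then show ?thesis
        using exp_sum_coefficient[OF A(1), of "fst j" "snd j"] by (simp only: simp_thms)
    next
      case False
      then show ?thesis by (simp only: simp_thms)
    qed
  qed
  \<comment> \<open>For every index, evaluation points and weights that extract its coefficient;
    outside \<open>Sigma K A\<close> the choice is arbitrary.\<close>
  then obtain n p y where rec: "\<forall>j. fst j \<in> K \<and> snd j \<in> A (fst j) \<longrightarrow>
      (\<forall>c. (\<Sum>i\<le>(n j::nat). p j i * (\<Sum>b\<in>A (fst j). c b * exp (b \<bullet> y j i))) = c (snd j))"
    unfolding choice_iff by (elim exE)
  define r where "r k a f = (\<Sum>i\<le>n (k, a). p (k, a) i * f (y (k, a) i)) / \<alpha> k a" for k a and f :: "real ^ 'm \<Rightarrow> real"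
  have r_F: "r k a (F k \<omega>) = \<xi> k a \<omega>" if "k \<in> K" "a \<in> A k" "\<omega> \<in> space M" for k a \<omega>
    using rec[rule_format, of "(k, a)" "\<lambda>b. \<xi> k b \<omega> * \<alpha> k b"] \<alpha>[OF that(1,2)] that
    by (simp add: r_def F)
  have r_meas[measurable]: "r k a \<in> borel_measurable (Pi\<^sub>M UNIV (\<lambda>_. borel))" for k a
    unfolding r_def by measurable
  let ?X = "\<lambda>\<omega>. \<lambda>j\<in>Sigma K A. \<xi> (fst j) (snd j) \<omega>"
  have X_meas: "?X \<in> measurable M (Pi\<^sub>M (Sigma K A) (\<lambda>_. borel))"
    by (rule measurable_restrict) auto
  show "distr M (Pi\<^sub>M (Sigma K A) (\<lambda>_. borel)) ?X = Pi\<^sub>M (Sigma K A) (\<lambda>_. std_gauss)"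
  proof (rule PiM_eqI[OF fin])
    show "sets (distr M (Pi\<^sub>M (Sigma K A) (\<lambda>_. borel)) ?X) = sets (Pi\<^sub>M (Sigma K A) (\<lambda>_. std_gauss))"
      by (simp cong: sets_PiM_cong)
  next
    fix E assume E: "\<And>j. j \<in> Sigma K A \<Longrightarrow> E j \<in> sets std_gauss"
    have E'[measurable]: "E (k, a) \<in> sets borel" if "k \<in> K" "a \<in> A k" for k a
      using E[of "(k, a)"] that by simp
    \<comment> \<open>The event on function space that the coefficients extracted from the k-th
      function lie in their sides of the box.\<close>
    define B where "B k = (\<Inter>a\<in>A k. r k a -` E (k, a) \<inter> space (Pi\<^sub>M UNIV (\<lambda>_. borel)))" for k
    have B: "B k \<in> sets (Pi\<^sub>M UNIV (\<lambda>_. borel))" if "k \<in> K" for k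
      unfolding B_def using A that by (intro sets.finite_INT measurable_sets[OF r_meas] E') auto
    have F_B: "F k \<omega> \<in> B k \<longleftrightarrow> (\<forall>a\<in>A k. \<xi> k a \<omega> \<in> E (k, a))" if "k \<in> K" "\<omega> \<in> space M" for k \<omega>
      using r_F[OF that(1) _ that(2)] by (simp add: B_def space_PiM)
    have FB: "F k -` B k \<inter> space M = (\<Inter>a\<in>A k. \<xi> k a -` E (k, a) \<inter> space M)" if "k \<in> K" for k
      using F_B[OF that] A(2)[OF that] by auto
    have "?X -` (Pi\<^sub>E (Sigma K A) E) \<inter> space M = (\<Inter>k\<in>K. F k -` B k \<inter> space M)"
    proof (rule set_eqI)
      fix \<omega>
      have "?X \<omega> \<in> Pi\<^sub>E (Sigma K A) E \<longleftrightarrow> (\<forall>k\<in>K. \<forall>a\<in>A k. \<xi> k a \<omega> \<in> E (k, a))"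
        by (auto simp: PiE_iff)
      then show "\<omega> \<in> ?X -` (Pi\<^sub>E (Sigma K A) E) \<inter> space M \<longleftrightarrow> \<omega> \<in> (\<Inter>k\<in>K. F k -` B k \<inter> space M)"
        using F_B K(2) by auto
    qed
    then have "emeasure (distr M (Pi\<^sub>M (Sigma K A) (\<lambda>_. borel)) ?X) (Pi\<^sub>E (Sigma K A) E) =
        prob (\<Inter>k\<in>K. F k -` B k \<inter> space M)"
      using X_meas E' fin by (subst emeasure_distr) (auto simp: emeasure_eq_measure intro!: sets_PiM_I_finite)
    also have "prob (\<Inter>k\<in>K. F k -` B k \<inter> space M) = (\<Prod>k\<in>K. prob (F k -` B k \<inter> space M))"
      by (rule indep_varsD_finite[OF F_indep K(2,1) B])
    also have "\<dots> = (\<Prod>k\<in>K. \<Prod>a\<in>A k. prob (\<xi> k a -` E (k, a) \<inter> space M))"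
    proof (rule prod.cong[OF refl])
      fix k assume k: "k \<in> K"
      show "prob (F k -` B k \<inter> space M) = (\<Prod>a\<in>A k. prob (\<xi> k a -` E (k, a) \<inter> space M))"
        unfolding FB[OF k] using E'[OF k] by (intro indep_varsD_finite[OF \<xi>_indep[OF k] A(2)[OF k] A(1)[OF k]]) auto
    qed
    also have "\<dots> = (\<Prod>j\<in>Sigma K A. prob (\<xi> (fst j) (snd j) -` E j \<inter> space M))"
      using K A by (subst prod.Sigma) (auto simp: case_prod_beta)
    also have "ennreal \<dots> = (\<Prod>j\<in>Sigma K A. emeasure std_gauss (E j))"
      unfolding prod_ennreal[OF measure_nonneg, symmetric]
    proof (rule prod.cong[OF refl])
      fix j assume j: "j \<in> Sigma K A"
      then have "fst j \<in> K" "snd j \<in> A (fst j)" by auto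
      note * = \<xi>_distr[OF this] \<xi>_meas[OF this]
      have "emeasure std_gauss (E j) = emeasure (distr M lborel (\<xi> (fst j) (snd j))) (E j)"
        unfolding std_gauss_def distributed_distr_eq_density[OF *(1)] ..
      also have "\<dots> = emeasure M (\<xi> (fst j) (snd j) -` E j \<inter> space M)"
        using *(2) E[OF j] by (subst emeasure_distr) auto
      finally show "ennreal (prob (\<xi> (fst j) (snd j) -` E j \<inter> space M)) = emeasure std_gauss (E j)"
        by (simp add: emeasure_eq_measure)
    qed
    finally show "emeasure (distr M (Pi\<^sub>M (Sigma K A) (\<lambda>_. borel)) ?X) (Pi\<^sub>E (Sigma K A) E) =
        (\<Prod>j\<in>Sigma K A. emeasure std_gauss (E j))" .
  qed
qed

section \<open>Standard Gaussian vectors and their Lebesgue density\<close>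

lemma PiM_std_gauss_eq_density:
  assumes "finite I"
  shows "Pi\<^sub>M I (\<lambda>_. std_gauss) = density (Pi\<^sub>M I (\<lambda>_. lborel)) (\<lambda>x. \<Prod>i\<in>I. ennreal (std_normal_density (x i)))"
proof -
  interpret G: product_sigma_finite "\<lambda>_. std_gauss" by (rule product_sigma_finite_std_gauss)
  interpret L: product_sigma_finite "\<lambda>_. lborel :: real measure"
    by (simp add: product_sigma_finite_def sigma_finite_lborel)
  have meas[measurable]: "(\<lambda>x. \<Prod>i\<in>I. ennreal (std_normal_density (x i))) \<in> borel_measurable (Pi\<^sub>M I (\<lambda>_. lborel))"
    by measurable
  show ?thesis
  proof (rule G.PiM_eqI[OF assms, symmetric])
    show "sets (density (Pi\<^sub>M I (\<lambda>_. lborel)) (\<lambda>x. \<Prod>i\<in>I. ennreal (std_normal_density (x i)))) = sets (Pi\<^sub>M I (\<lambda>_. std_gauss))"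
      by (simp cong: sets_PiM_cong)
  next
    fix E assume "\<And>i. i \<in> I \<Longrightarrow> E i \<in> sets std_gauss"
    then have E[measurable]: "\<And>i. i \<in> I \<Longrightarrow> E i \<in> sets borel" by simp
    have box: "Pi\<^sub>E I E \<in> sets (Pi\<^sub>M I (\<lambda>_. lborel))"
      using E assms by (intro sets_PiM_I_finite) auto
    have "emeasure (density (Pi\<^sub>M I (\<lambda>_. lborel)) (\<lambda>x. \<Prod>i\<in>I. ennreal (std_normal_density (x i)))) (Pi\<^sub>E I E) =
        (\<integral>\<^sup>+x. (\<Prod>i\<in>I. ennreal (std_normal_density (x i))) * indicator (Pi\<^sub>E I E) x \<partial>Pi\<^sub>M I (\<lambda>_. lborel))"
      by (rule emeasure_density[OF meas box])
    also have "\<dots> = (\<integral>\<^sup>+x. (\<Prod>i\<in>I. ennreal (std_normal_density (x i)) * indicator (E i) (x i)) \<partial>Pi\<^sub>M I (\<lambda>_. lborel))"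
    proof (rule nn_integral_cong)
      fix x :: "'a \<Rightarrow> real" assume "x \<in> space (Pi\<^sub>M I (\<lambda>_. lborel))"
      then have x: "x \<in> extensional I" by (simp add: space_PiM PiE_iff)
      have "(indicator (Pi\<^sub>E I E) x :: ennreal) = (\<Prod>i\<in>I. indicator (E i) (x i))"
      proof (cases "\<forall>i\<in>I. x i \<in> E i")
        case True
        then show ?thesis using x by (simp add: PiE_iff)
      next
        case False
        then obtain i where "i \<in> I" "x i \<notin> E i" by blast
        then have "(\<Prod>i\<in>I. indicator (E i) (x i) :: ennreal) = 0"
          using assms by (intro prod_zero) (auto intro!: bexI[of _ i])
        then show ?thesis using False by (auto simp: PiE_iff split: split_indicator)
      qed
      then show "(\<Prod>i\<in>I. ennreal (std_normal_density (x i))) * indicator (Pi\<^sub>E I E) x =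
          (\<Prod>i\<in>I. ennreal (std_normal_density (x i)) * indicator (E i) (x i))"
        by (simp add: prod.distrib)
    qed
    also have "\<dots> = (\<Prod>i\<in>I. \<integral>\<^sup>+t. ennreal (std_normal_density t) * indicator (E i) t \<partial>lborel)"
      by (rule L.product_nn_integral_prod[OF assms]) measurable
    also have "\<dots> = (\<Prod>i\<in>I. emeasure std_gauss (E i))"
      unfolding std_gauss_def by (intro prod.cong refl emeasure_density[symmetric]) (use E in auto)
    finally show "emeasure (density (Pi\<^sub>M I (\<lambda>_. lborel)) (\<lambda>x. \<Prod>i\<in>I. ennreal (std_normal_density (x i)))) (Pi\<^sub>E I E) =
        (\<Prod>i\<in>I. emeasure std_gauss (E i))" .
  qed
qed

definition std_normal_density_vec :: "real ^ 'n \<Rightarrow> real" where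
  "std_normal_density_vec z = (\<Prod>k\<in>UNIV. std_normal_density (z $ k))"

lemma std_normal_density_vec_nonneg: "0 \<le> std_normal_density_vec z"
  by (simp add: std_normal_density_vec_def prod_nonneg)

lemma borel_measurable_std_normal_density_vec[measurable]: "std_normal_density_vec \<in> borel_measurable borel"
  unfolding std_normal_density_vec_def by measurable

text \<open>The pivots are coordinates in a product over coefficient indices, while the area formula
  integrates over vectors. The link is that Lebesgue measure on vectors is the image of the product
  measure over \<open>Basis\<close>, whose elements are matched with the pivot indices by
  \<open>idx\<close>.\<close>

lemma nn_integral_PiM_std_gauss_vec:
  fixes g :: "real ^ 'n \<Rightarrow> ennreal" and idx :: "'n \<Rightarrow> 'i"
  assumes g[measurable]: "g \<in> borel_measurable borel" and idx: "inj idx"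
  shows "(\<integral>\<^sup>+\<zeta>. g (\<chi> k. \<zeta> (idx k)) \<partial>Pi\<^sub>M (range idx) (\<lambda>_. std_gauss)) =
    (\<integral>\<^sup>+z. ennreal (std_normal_density_vec z) * g z \<partial>lborel)"
proof -
  let ?B = "Basis :: (real ^ 'n) set"
  define f where "f b = idx (axis_index b)" for b :: "real ^ 'n"
  have f_axis: "f (axis k 1) = idx k" for k
    by (simp add: f_def)
  have f: "inj_on f ?B" "f \<in> ?B \<rightarrow> range idx"
    using idx by (auto simp: inj_on_def f_def Basis_vec_def)
  have Basis_eq: "?B = range (\<lambda>k. axis k 1)" by (auto simp: Basis_vec_def)
  have axis_inj: "inj (\<lambda>k :: 'n. axis k (1 :: real))"
    by (auto simp: inj_on_def axis_eq_axis)
  have rep: "(\<Sum>b\<in>?B. x b *\<^sub>R b) = (\<chi> k. x (axis k 1))" for x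
    unfolding Basis_eq
    unfolding sum.reindex[OF axis_inj] by (simp add: vec_eq_iff) (simp add: axis_def if_distrib cong: if_cong)
  have Brep: "(\<Prod>b\<in>?B. h b) = (\<Prod>k\<in>UNIV. h (axis k 1))" for h :: "real ^ 'n \<Rightarrow> ennreal"
    unfolding Basis_eq prod.reindex[OF axis_inj] by simp
  have sum_meas[measurable]: "(\<lambda>x. \<Sum>b\<in>?B. x b *\<^sub>R b) \<in> borel_measurable (Pi\<^sub>M ?B (\<lambda>_. lborel))"
    by measurable
  have T: "(\<lambda>\<zeta>. \<lambda>b\<in>?B. \<zeta> (f b)) \<in> measurable (Pi\<^sub>M (range idx) (\<lambda>_. std_gauss)) (Pi\<^sub>M ?B (\<lambda>_. std_gauss))"
    using f(2) by (intro measurable_restrict measurable_component_singleton) auto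
  have g_meas: "(\<lambda>x. g (\<chi> k. x (axis k 1))) \<in> borel_measurable (Pi\<^sub>M ?B (\<lambda>_. std_gauss))"
    unfolding rep[symmetric] by measurable
  have "(\<integral>\<^sup>+z. ennreal (std_normal_density_vec z) * g z \<partial>lborel) =
      (\<integral>\<^sup>+x. ennreal (std_normal_density_vec (\<Sum>b\<in>?B. x b *\<^sub>R b)) * g (\<Sum>b\<in>?B. x b *\<^sub>R b) \<partial>Pi\<^sub>M ?B (\<lambda>_. lborel))"
    by (subst lborel_eq) (rule nn_integral_distr, auto)
  also have "\<dots> = (\<integral>\<^sup>+x. (\<Prod>b\<in>?B. ennreal (std_normal_density (x b))) * g (\<chi> k. x (axis k 1)) \<partial>Pi\<^sub>M ?B (\<lambda>_. lborel))"
    by (simp add: rep Brep std_normal_density_vec_def prod_ennreal)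
  also have "\<dots> = (\<integral>\<^sup>+x. g (\<chi> k. x (axis k 1)) \<partial>Pi\<^sub>M ?B (\<lambda>_. std_gauss))"
    unfolding PiM_std_gauss_eq_density[OF finite_Basis] rep[symmetric]
    by (rule nn_integral_density[symmetric]) measurable
  also have "Pi\<^sub>M ?B (\<lambda>_. std_gauss) =
      distr (Pi\<^sub>M (range idx) (\<lambda>_. std_gauss)) (Pi\<^sub>M ?B (\<lambda>_. std_gauss)) (\<lambda>\<zeta>. \<lambda>b\<in>?B. \<zeta> (f b))"
    by (rule distr_PiM_reindex[OF _ f, symmetric]) (rule prob_space_std_gauss)
  also have "(\<integral>\<^sup>+x. g (\<chi> k. x (axis k 1)) \<partial>\<dots>) =
      (\<integral>\<^sup>+\<zeta>. g (\<chi> k. (\<lambda>b\<in>?B. \<zeta> (f b)) (axis k 1)) \<partial>Pi\<^sub>M (range idx) (\<lambda>_. std_gauss))"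
    by (rule nn_integral_distr[OF T]) (simp add: g_meas)
  also have "\<dots> = (\<integral>\<^sup>+\<zeta>. g (\<chi> k. \<zeta> (idx k)) \<partial>Pi\<^sub>M (range idx) (\<lambda>_. std_gauss))"
    by (simp add: f_axis)
  finally show ?thesis ..
qed

lemma integrable_std_normal_density_vec: "integrable lborel (std_normal_density_vec :: real ^ 'n \<Rightarrow> real)"
proof (rule integrableI_bounded)
  interpret prob_space "Pi\<^sub>M (range (id :: 'n \<Rightarrow> 'n)) (\<lambda>_. std_gauss)"
    by (rule prob_space_PiM) (rule prob_space_std_gauss)
  have "(\<integral>\<^sup>+z. ennreal (std_normal_density_vec (z :: real ^ 'n)) * 1 \<partial>lborel) = 1"
    using nn_integral_PiM_std_gauss_vec[of "\<lambda>_ :: real ^ 'n. 1" id] emeasure_space_1 by simp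
  then show "(\<integral>\<^sup>+z. ennreal (norm (std_normal_density_vec (z :: real ^ 'n))) \<partial>lborel) < \<infinity>"
    by (simp add: std_normal_density_vec_nonneg)
qed simp

lemma borel_measurable_det:
  fixes f :: "'z \<Rightarrow> real ^ 'n ^ 'n"
  assumes [measurable]: "\<And>i j. (\<lambda>x. f x $ i $ j) \<in> borel_measurable M"
  shows "(\<lambda>x. det (f x)) \<in> borel_measurable M"
  unfolding det_def by measurable

section \<open>The Kac--Rice formula\<close>

text \<open>Coefficients are indexed by labels b, and e turns labels into exponents. This lets the
  exponents move to another coordinate space, by \<open>order_coords\<close>, while the coefficients
  keep their original indices.\<close>

definition exp_sum :: "'b set \<Rightarrow> ('b \<Rightarrow> real) \<Rightarrow> ('b \<Rightarrow> 'a::euclidean_space) \<Rightarrow> ('b \<Rightarrow> real) \<Rightarrow> 'a \<Rightarrow> real" where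
  "exp_sum A \<alpha> e c y = (\<Sum>b\<in>A. c b * \<alpha> b * exp (e b \<bullet> y))"

text \<open>The quotient of the b-term by the pivot term, with the sign that comes from moving it to
  the other side of the equation.\<close>

definition pivot_weight :: "('b \<Rightarrow> real) \<Rightarrow> ('b \<Rightarrow> 'a::euclidean_space) \<Rightarrow> 'b \<Rightarrow> 'b \<Rightarrow> 'a \<Rightarrow> real" where
  "pivot_weight \<alpha> e q b y = - (\<alpha> b / \<alpha> q * exp ((e b - e q) \<bullet> y))"

text \<open>The value that the coefficient at \<open>q\<close> must take for the exponential sum to vanish
  at \<open>y\<close>, and its gradient in \<open>y\<close>.\<close>

definition pivot_value :: "'b set \<Rightarrow> ('b \<Rightarrow> real) \<Rightarrow> ('b \<Rightarrow> 'a::euclidean_space) \<Rightarrow> 'b \<Rightarrow> ('b \<Rightarrow> real) \<Rightarrow> 'a \<Rightarrow> real" where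
  "pivot_value A \<alpha> e q c y = (\<Sum>b\<in>A - {q}. c b * pivot_weight \<alpha> e q b y)"

definition pivot_grad :: "'b set \<Rightarrow> ('b \<Rightarrow> real) \<Rightarrow> ('b \<Rightarrow> 'a::euclidean_space) \<Rightarrow> 'b \<Rightarrow> ('b \<Rightarrow> real) \<Rightarrow> 'a \<Rightarrow> 'a" where
  "pivot_grad A \<alpha> e q c y = (\<Sum>b\<in>A - {q}. (c b * pivot_weight \<alpha> e q b y) *\<^sub>R (e b - e q))"

lemma exp_sum_eq_0_iff:
  assumes "finite A" "q \<in> A" "\<alpha> q > 0"
  shows "exp_sum A \<alpha> e c y = 0 \<longleftrightarrow> pivot_value A \<alpha> e q c y = c q"
proof -
  have "c b * \<alpha> b * exp (e b \<bullet> y) = - (\<alpha> q * exp (e q \<bullet> y)) * (c b * pivot_weight \<alpha> e q b y)" for b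
    using assms(3) by (simp add: pivot_weight_def inner_diff_left exp_diff)
  then have "exp_sum A \<alpha> e c y = \<alpha> q * exp (e q \<bullet> y) * (c q - pivot_value A \<alpha> e q c y)"
    unfolding exp_sum_def pivot_value_def using assms(1,2)
    by (subst sum.remove[of A q]) (simp_all add: sum_distrib_left algebra_simps sum_negf)
  then show ?thesis
    using assms(3) by auto
qed

lemma pivot_value_has_derivative:
  fixes e :: "'b \<Rightarrow> 'a::euclidean_space"
  shows "(pivot_value A \<alpha> e q c has_derivative (\<lambda>h. pivot_grad A \<alpha> e q c y \<bullet> h)) (at y)"
proof -
  have "((\<lambda>y. k * exp (v \<bullet> y)) has_derivative (\<lambda>h. k * exp (v \<bullet> y) * (v \<bullet> h))) (at y)" for k and v :: 'a
    by (auto intro!: derivative_eq_intros)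
  from this[of "- (\<alpha> b / \<alpha> q)" "e b - e q" for b]
  have "(pivot_weight \<alpha> e q b has_derivative (\<lambda>h. pivot_weight \<alpha> e q b y * ((e b - e q) \<bullet> h))) (at y)" for b
    by (simp add: pivot_weight_def[abs_def])
  then have "((\<lambda>y. \<Sum>b\<in>A - {q}. c b * pivot_weight \<alpha> e q b y) has_derivative
      (\<lambda>h. \<Sum>b\<in>A - {q}. c b * (pivot_weight \<alpha> e q b y * ((e b - e q) \<bullet> h)))) (at y)"
    by (intro has_derivative_sum has_derivative_mult_right)
  then show ?thesis
    unfolding pivot_value_def[abs_def] pivot_grad_def by (simp add: inner_sum_left mult.assoc)
qed

lemma continuous_on_pivot_grad: "continuous_on S (pivot_grad A \<alpha> e q c)"
  unfolding pivot_grad_def[abs_def] pivot_weight_def by (intro continuous_intros)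

lemma continuous_on_exp_sum: "continuous_on S (exp_sum A \<alpha> e c)"
  unfolding exp_sum_def[abs_def] by (intro continuous_intros)

lemma borel_measurable_pivot_value:
  assumes "\<And>b. b \<in> A - {q} \<Longrightarrow> (\<lambda>z. c z b) \<in> borel_measurable M" and [measurable]: "y \<in> borel_measurable M"
  shows "(\<lambda>z. pivot_value A \<alpha> e q (c z) (y z)) \<in> borel_measurable M"
  unfolding pivot_value_def pivot_weight_def
  by (intro borel_measurable_sum borel_measurable_times assms(1)) measurable

lemma borel_measurable_pivot_grad:
  assumes "\<And>b. b \<in> A - {q} \<Longrightarrow> (\<lambda>z. c z b) \<in> borel_measurable M" and [measurable]: "y \<in> borel_measurable M"
  shows "(\<lambda>z. pivot_grad A \<alpha> e q (c z) (y z)) \<in> borel_measurable M"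
  unfolding pivot_grad_def pivot_weight_def
  by (intro borel_measurable_sum borel_measurable_scaleR borel_measurable_times borel_measurable_const assms(1)) measurable

lemma pivot_value_cong:
  "(\<And>b. b \<in> A - {q} \<Longrightarrow> c b = c' b) \<Longrightarrow> pivot_value A \<alpha> e q c y = pivot_value A \<alpha> e q c' y"
  unfolding pivot_value_def by (rule sum.cong) auto

lemma pivot_grad_cong:
  "(\<And>b. b \<in> A - {q} \<Longrightarrow> c b = c' b) \<Longrightarrow> pivot_grad A \<alpha> e q c y = pivot_grad A \<alpha> e q c' y"
  unfolding pivot_grad_def by (rule sum.cong) auto

text \<open>Up to normalization by the moment of order 0, these are the moments of the functional \<open>L\<close> at a
  random exponent \<open>e b\<close>.\<close>

definition exp_moment :: "'b set \<Rightarrow> ('b \<Rightarrow> real) \<Rightarrow> ('b \<Rightarrow> 'a::euclidean_space) \<Rightarrow> 'a \<Rightarrow> ('a \<Rightarrow> real) \<Rightarrow> nat \<Rightarrow> real" where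
  "exp_moment A \<alpha> e y L r = (\<Sum>b\<in>A. (\<alpha> b * exp (e b \<bullet> y))\<^sup>2 * L (e b) ^ r)"

definition exp_var :: "'b set \<Rightarrow> ('b \<Rightarrow> real) \<Rightarrow> ('b \<Rightarrow> 'a::euclidean_space) \<Rightarrow> 'a \<Rightarrow> ('a \<Rightarrow> real) \<Rightarrow> real" where
  "exp_var A \<alpha> e y L = exp_moment A \<alpha> e y L 2 / exp_moment A \<alpha> e y L 0 -
     (exp_moment A \<alpha> e y L 1 / exp_moment A \<alpha> e y L 0)\<^sup>2"

lemma exp_moment_0_pos:
  assumes "finite A" "A \<noteq> {}" "\<And>b. b \<in> A \<Longrightarrow> \<alpha> b > 0"
  shows "exp_moment A \<alpha> e y L 0 > 0"
proof -
  have "(\<alpha> b * exp (e b \<bullet> y))\<^sup>2 * L (e b) ^ 0 > 0" if "b \<in> A" for b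
    using assms(3)[OF that] by simp
  then show ?thesis
    unfolding exp_moment_def using assms(1,2) by (intro sum_pos)
qed

text \<open>Squared pivot weights are the weights of the random exponent relative to that of q, so W
  is the full normalization divided by the weight of q. What remains is the invariance of a variance
  under the shift by \<open>L (e q)\<close>.\<close>

lemma exp_var_pivot:
  fixes e :: "'b \<Rightarrow> 'a::euclidean_space" and y :: 'a
  assumes A: "finite A" "q \<in> A" "\<And>b. b \<in> A \<Longrightarrow> \<alpha> b > 0" and L: "linear L"
  defines "W \<equiv> 1 + (\<Sum>b\<in>A - {q}. (pivot_weight \<alpha> e q b y)\<^sup>2)"
  shows "(\<Sum>b\<in>A - {q}. (pivot_weight \<alpha> e q b y * L (e b - e q))\<^sup>2) / W -
      ((\<Sum>b\<in>A - {q}. pivot_weight \<alpha> e q b y * L (e b - e q) * pivot_weight \<alpha> e q b y) / W)\<^sup>2 = exp_var A \<alpha> e y L"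
proof -
  define K where "K = exp_moment A \<alpha> e y L"
  define s where "s = (\<alpha> q * exp (e q \<bullet> y))\<^sup>2"
  define l where "l = L (e q)"
  have s: "s > 0" using A(3)[OF A(2)] by (simp add: s_def)
  have K0: "K 0 > 0" unfolding K_def using A by (intro exp_moment_0_pos) auto
  have w: "(pivot_weight \<alpha> e q b y)\<^sup>2 = (\<alpha> b * exp (e b \<bullet> y))\<^sup>2 / s" for b
    by (simp add: pivot_weight_def s_def inner_diff_left exp_diff power_mult_distrib power_divide)
  \<comment> \<open>The term \<open>0 ^ r\<close> stands for the omitted summand b = q: its weight
    is 1 and its deviation is 0, so it counts 1 for r = 0 and 0 for r > 0.\<close>
  have ext: "(\<Sum>b\<in>A - {q}. (pivot_weight \<alpha> e q b y)\<^sup>2 * (L (e b) - l) ^ r) + 0 ^ r =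
      (\<Sum>b\<in>A. (\<alpha> b * exp (e b \<bullet> y))\<^sup>2 * (L (e b) - l) ^ r) / s" for r
  proof -
    have "(\<Sum>b\<in>A. (\<alpha> b * exp (e b \<bullet> y))\<^sup>2 * (L (e b) - l) ^ r) / s =
        (\<Sum>b\<in>A. (pivot_weight \<alpha> e q b y)\<^sup>2 * (L (e b) - l) ^ r)"
      unfolding w sum_divide_distrib by simp
    also have "\<dots> = (pivot_weight \<alpha> e q q y)\<^sup>2 * 0 ^ r + (\<Sum>b\<in>A - {q}. (pivot_weight \<alpha> e q b y)\<^sup>2 * (L (e b) - l) ^ r)"
      using A by (subst sum.remove[of A q]) (auto simp: l_def)
    also have "(pivot_weight \<alpha> e q q y)\<^sup>2 = 1"
      using s unfolding w by (simp add: s_def)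
    finally show ?thesis by simp
  qed
  have W: "W = K 0 / s"
    using ext[of 0] by (simp add: W_def K_def exp_moment_def)
  have "(\<Sum>b\<in>A. (\<alpha> b * exp (e b \<bullet> y))\<^sup>2 * (L (e b) - l) ^ 2) = K 2 - 2 * l * K 1 + l\<^sup>2 * K 0"
    unfolding K_def exp_moment_def sum_distrib_left sum_subtractf[symmetric] sum.distrib[symmetric]
    by (intro sum.cong) (auto simp: power2_eq_square algebra_simps)
  then have S2: "(\<Sum>b\<in>A - {q}. (pivot_weight \<alpha> e q b y * L (e b - e q))\<^sup>2) = (K 2 - 2 * l * K 1 + l\<^sup>2 * K 0) / s"
    using ext[of 2] by (simp add: linear_diff[OF L] l_def power_mult_distrib)
  have "(\<Sum>b\<in>A. (\<alpha> b * exp (e b \<bullet> y))\<^sup>2 * (L (e b) - l) ^ 1) = K 1 - l * K 0"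
    unfolding K_def exp_moment_def sum_distrib_left sum_subtractf[symmetric]
    by (intro sum.cong) (auto simp: algebra_simps)
  moreover have "(\<Sum>b\<in>A - {q}. pivot_weight \<alpha> e q b y * L (e b - e q) * pivot_weight \<alpha> e q b y) =
      (\<Sum>b\<in>A - {q}. (pivot_weight \<alpha> e q b y)\<^sup>2 * (L (e b) - l) ^ 1)"
    by (intro sum.cong) (auto simp: linear_diff[OF L] l_def power2_eq_square)
  ultimately have S1: "(\<Sum>b\<in>A - {q}. pivot_weight \<alpha> e q b y * L (e b - e q) * pivot_weight \<alpha> e q b y) = (K 1 - l * K 0) / s"
    using ext[of 1] by simp
  have "((K 2 - 2 * l * K 1 + l\<^sup>2 * K 0) / s) / (K 0 / s) - (((K 1 - l * K 0) / s) / (K 0 / s))\<^sup>2 =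
      K 2 / K 0 - (K 1 / K 0)\<^sup>2"
  proof -
    have "((K 2 - 2 * l * K 1 + l\<^sup>2 * K 0) / s) / (K 0 / s) = K 2 / K 0 - 2 * l * (K 1 / K 0) + l\<^sup>2"
      using s K0 by (simp add: field_simps)
    moreover have "((K 1 - l * K 0) / s) / (K 0 / s) = K 1 / K 0 - l"
      using s K0 by (simp add: field_simps)
    ultimately show ?thesis
      by (simp only:) (simp add: power2_eq_square algebra_simps)
  qed
  then show ?thesis
    unfolding S1 S2 W exp_var_def K_def .
qed

lemma borel_measurable_exp_var:
  fixes e :: "'b \<Rightarrow> 'a::euclidean_space"
  assumes [measurable]: "y \<in> borel_measurable M" "\<And>v. (\<lambda>z. L z v) \<in> borel_measurable M"
  shows "(\<lambda>z. exp_var A \<alpha> e (y z) (L z)) \<in> borel_measurable M"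
  unfolding exp_var_def exp_moment_def by measurable

lemma borel_measurable_nth:
  fixes f :: "'z \<Rightarrow> real ^ 'n"
  assumes "f \<in> borel_measurable M"
  shows "(\<lambda>z. f z $ j) \<in> borel_measurable M"
  using assms by (rule measurable_compose) (intro borel_measurable_continuous_onI continuous_intros)

context
  fixes A :: "'n::{finite,wellorder} \<Rightarrow> 'b set" and \<alpha> :: "'n \<Rightarrow> 'b \<Rightarrow> real"
    and e :: "'b \<Rightarrow> real ^ 'n::{finite,wellorder}" and q :: "'n \<Rightarrow> 'b"
  assumes A: "\<And>k. finite (A k)" "\<And>k. q k \<in> A k" "\<And>k b. b \<in> A k \<Longrightarrow> \<alpha> k b > 0"
begin

lemma borel_measurable_ncard_exp_sum:
  assumes "open V" and c: "\<And>k b. b \<in> A k \<Longrightarrow> (\<lambda>z. c z (k, b)) \<in> borel_measurable M"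
  shows "(\<lambda>z. ncard {y\<in>V. \<forall>k. exp_sum (A k) (\<alpha> k) e (\<lambda>b. c z (k, b)) y = 0}) \<in> borel_measurable M"
proof -
  \<comment> \<open>A simultaneous zero of the system is a zero of one continuous function, the sum
    of the absolute values.\<close>
  have "(\<lambda>z. ncard {y\<in>V. (\<Sum>k\<in>UNIV. \<bar>exp_sum (A k) (\<alpha> k) e (\<lambda>b. c z (k, b)) y\<bar>) = 0}) \<in> borel_measurable M"
  proof (rule borel_measurable_ncard_zeros[OF _ _ assms(1)])
    fix y
    have "(\<lambda>z. exp_sum (A k) (\<alpha> k) e (\<lambda>b. c z (k, b)) y) \<in> borel_measurable M" for k
      unfolding exp_sum_def by (intro borel_measurable_sum borel_measurable_times c borel_measurable_const)
    then show "(\<lambda>z. \<Sum>k\<in>UNIV. \<bar>exp_sum (A k) (\<alpha> k) e (\<lambda>b. c z (k, b)) y\<bar>) \<in> borel_measurable M"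
      by measurable
  next
    fix z
    show "continuous_on V (\<lambda>y. \<Sum>k\<in>UNIV. \<bar>exp_sum (A k) (\<alpha> k) e (\<lambda>b. c z (k, b)) y\<bar>)"
      by (intro continuous_intros continuous_on_exp_sum)
  qed
  then show ?thesis
    by (simp add: sum_nonneg_eq_0_iff)
qed

text \<open>With the non-pivot coefficients frozen at \<eta>, the map T does not depend on the
  pivots, so \<zeta> enters only as the level whose preimages are counted. The area formula applies
  with the Gaussian density of \<zeta>.\<close>

lemma nn_integral_ncard_pivots:
  assumes V: "open V"
  defines "J' \<equiv> Sigma UNIV (\<lambda>k. A k - {q k})" and "P \<equiv> range (\<lambda>k. (k, q k))"
  shows "(\<integral>\<^sup>+\<zeta>. ncard {y\<in>V. \<forall>k. exp_sum (A k) (\<alpha> k) e (\<lambda>b. merge J' P (\<eta>, \<zeta>) (k, b)) y = 0} \<partial>Pi\<^sub>M P (\<lambda>_. std_gauss)) =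
    (\<integral>\<^sup>+y. ennreal (\<bar>det (\<chi> k. pivot_grad (A k) (\<alpha> k) e (q k) (\<lambda>b. \<eta> (k, b)) y)\<bar> *
      std_normal_density_vec (\<chi> k. pivot_value (A k) (\<alpha> k) e (q k) (\<lambda>b. \<eta> (k, b)) y)) * indicator V y \<partial>lborel)"
proof -
  let ?T = "\<lambda>y. \<chi> k. pivot_value (A k) (\<alpha> k) e (q k) (\<lambda>b. \<eta> (k, b)) y"
  let ?G = "\<lambda>y. \<chi> k. pivot_grad (A k) (\<alpha> k) e (q k) (\<lambda>b. \<eta> (k, b)) y"
  have der: "(?T has_derivative (*v) (?G y)) (at y)" for y
  proof (rule has_derivative_componentwise_within[THEN iffD2], rule ballI)
    fix i :: "real ^ 'n::_" assume "i \<in> Basis"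
    then obtain k where i: "i = axis k 1" by (auto simp: Basis_vec_def)
    show "((\<lambda>x. ?T x \<bullet> i) has_derivative (\<lambda>h. (?G y *v h) \<bullet> i)) (at y)"
      using pivot_value_has_derivative[of "A k" "\<alpha> k" e "q k" "\<lambda>b. \<eta> (k, b)" y]
      unfolding i cart_eq_inner_axis[symmetric] by (simp add: matrix_vector_mult_def inner_vec_def)
  qed
  have cont: "continuous_on UNIV (\<lambda>y. ?G y $ i $ j)" for i j
    by (simp add: continuous_on_pivot_grad continuous_on_component)
  have cont_T: "continuous_on UNIV ?T"
    by (rule has_derivative_continuous_on) (rule has_derivative_at_withinI[OF der])
  have "{y\<in>V. \<forall>k. exp_sum (A k) (\<alpha> k) e (\<lambda>b. merge J' P (\<eta>, \<zeta>) (k, b)) y = 0} =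
      {y\<in>V. ?T y = (\<chi> k. \<zeta> (k, q k))}" for \<zeta>
  proof -
    have "pivot_value (A k) (\<alpha> k) e (q k) (\<lambda>b. merge J' P (\<eta>, \<zeta>) (k, b)) y =
        pivot_value (A k) (\<alpha> k) e (q k) (\<lambda>b. \<eta> (k, b)) y" for k y
      by (rule pivot_value_cong) (auto simp: merge_def J'_def)
    moreover have "merge J' P (\<eta>, \<zeta>) (k, q k) = \<zeta> (k, q k)" for k
      by (simp add: merge_def J'_def P_def)
    ultimately have "exp_sum (A k) (\<alpha> k) e (\<lambda>b. merge J' P (\<eta>, \<zeta>) (k, b)) y = 0 \<longleftrightarrow>
        pivot_value (A k) (\<alpha> k) e (q k) (\<lambda>b. \<eta> (k, b)) y = \<zeta> (k, q k)" for k y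
      using exp_sum_eq_0_iff[of "A k" "q k" "\<alpha> k" e "\<lambda>b. merge J' P (\<eta>, \<zeta>) (k, b)" y, OF A(1) A(2) A(3)[OF A(2)]]
      by (simp only:)
    then show ?thesis
      by (simp add: vec_eq_iff)
  qed
  then have "(\<integral>\<^sup>+\<zeta>. ncard {y\<in>V. \<forall>k. exp_sum (A k) (\<alpha> k) e (\<lambda>b. merge J' P (\<eta>, \<zeta>) (k, b)) y = 0} \<partial>Pi\<^sub>M P (\<lambda>_. std_gauss)) =
      (\<integral>\<^sup>+\<zeta>. ncard {y\<in>V. ?T y = (\<chi> k. \<zeta> (k, q k))} \<partial>Pi\<^sub>M P (\<lambda>_. std_gauss))"
    by (simp only:)
  also have "\<dots> = (\<integral>\<^sup>+z. ennreal (std_normal_density_vec z) * ncard {y\<in>V. ?T y = z} \<partial>lborel)"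
    unfolding P_def
  proof (rule nn_integral_PiM_std_gauss_vec)
    \<comment> \<open>Preimages of z are written as the zeros of a scalar function that is
      continuous in y, the form in which zero counts are known to be measurable.\<close>
    have "(\<lambda>z. ncard {y\<in>V. norm (?T y - z) = 0}) \<in> borel_measurable borel"
      by (rule borel_measurable_ncard_zeros[OF _ _ V])
         (auto intro!: continuous_on_norm continuous_on_diff continuous_on_const continuous_on_subset[OF cont_T])
    then show "(\<lambda>z. ncard {y\<in>V. ?T y = z}) \<in> borel_measurable borel"
      by simp
  qed (auto simp: inj_on_def)
  also have "\<dots> = (\<integral>\<^sup>+y. ennreal (\<bar>det (?G y)\<bar> * std_normal_density_vec (?T y)) * indicator V y \<partial>lborel)"
    by (rule area_formula[OF V der cont integrable_std_normal_density_vec std_normal_density_vec_nonneg])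
  finally show ?thesis .
qed

lemma nn_integral_ncard_exp_sum:
  assumes V: "open V"
  shows "(\<integral>\<^sup>+c. ncard {y\<in>V. \<forall>k. exp_sum (A k) (\<alpha> k) e (\<lambda>b. c (k, b)) y = 0} \<partial>Pi\<^sub>M (Sigma UNIV A) (\<lambda>_. std_gauss)) =
    (\<integral>\<^sup>+\<eta>. \<integral>\<^sup>+y. ennreal (\<bar>det (\<chi> k. pivot_grad (A k) (\<alpha> k) e (q k) (\<lambda>b. \<eta> (k, b)) y)\<bar> *
      std_normal_density_vec (\<chi> k. pivot_value (A k) (\<alpha> k) e (q k) (\<lambda>b. \<eta> (k, b)) y)) * indicator V y
      \<partial>lborel \<partial>Pi\<^sub>M (Sigma UNIV (\<lambda>k. A k - {q k})) (\<lambda>_. std_gauss))"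
proof -
  interpret product_sigma_finite "\<lambda>_. std_gauss" by (rule product_sigma_finite_std_gauss)
  define J' P where "J' = Sigma UNIV (\<lambda>k. A k - {q k})" and "P = range (\<lambda>k. (k, q k))"
  have J: "Sigma UNIV A = J' \<union> P"
    using A(2) by (auto simp: J'_def P_def)
  have fin: "finite J'" "finite P" "J' \<inter> P = {}"
    using A(1) by (auto simp: J'_def P_def)
  have meas: "(\<lambda>c. ncard {y\<in>V. \<forall>k. exp_sum (A k) (\<alpha> k) e (\<lambda>b. c (k, b)) y = 0})
      \<in> borel_measurable (Pi\<^sub>M (Sigma UNIV A) (\<lambda>_. std_gauss))"
    by (rule borel_measurable_ncard_exp_sum[OF V]) (auto simp flip: sets_std_gauss cong: measurable_cong_sets)
  have "(\<integral>\<^sup>+c. ncard {y\<in>V. \<forall>k. exp_sum (A k) (\<alpha> k) e (\<lambda>b. c (k, b)) y = 0} \<partial>Pi\<^sub>M (Sigma UNIV A) (\<lambda>_. std_gauss)) =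
      (\<integral>\<^sup>+\<eta>. \<integral>\<^sup>+\<zeta>. ncard {y\<in>V. \<forall>k. exp_sum (A k) (\<alpha> k) e (\<lambda>b. merge J' P (\<eta>, \<zeta>) (k, b)) y = 0}
        \<partial>Pi\<^sub>M P (\<lambda>_. std_gauss) \<partial>Pi\<^sub>M J' (\<lambda>_. std_gauss))"
    unfolding J by (rule product_nn_integral_fold[OF fin(3,1,2) meas[unfolded J]])
  then show ?thesis
    unfolding J'_def P_def nn_integral_ncard_pivots[OF V] .
qed

lemma borel_measurable_kac_rice_integrand:
  assumes c: "\<And>k b. b \<in> A k - {q k} \<Longrightarrow> (\<lambda>z. c z (k, b)) \<in> borel_measurable M"
    and y[measurable]: "y \<in> borel_measurable M" and V[measurable]: "V \<in> sets borel"
  shows "(\<lambda>z. ennreal (\<bar>det (\<chi> k. pivot_grad (A k) (\<alpha> k) e (q k) (\<lambda>b. c z (k, b)) (y z))\<bar> *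
      std_normal_density_vec (\<chi> k. pivot_value (A k) (\<alpha> k) e (q k) (\<lambda>b. c z (k, b)) (y z))) * indicator V (y z))
    \<in> borel_measurable M"
proof -
  have [measurable]: "(\<lambda>z. pivot_value (A k) (\<alpha> k) e (q k) (\<lambda>b. c z (k, b)) (y z)) \<in> borel_measurable M" for k
    by (rule borel_measurable_pivot_value[OF c y])
  have [measurable]: "(\<lambda>z. pivot_grad (A k) (\<alpha> k) e (q k) (\<lambda>b. c z (k, b)) (y z)) \<in> borel_measurable M" for k
    by (rule borel_measurable_pivot_grad[OF c y])
  have [measurable]: "(\<lambda>z. pivot_grad (A k) (\<alpha> k) e (q k) (\<lambda>b. c z (k, b)) (y z) $ j) \<in> borel_measurable M" for k j
    by (rule borel_measurable_nth) measurable
  have [measurable]: "(\<lambda>z. det (\<chi> k. pivot_grad (A k) (\<alpha> k) e (q k) (\<lambda>b. c z (k, b)) (y z))) \<in> borel_measurable M"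
    by (rule borel_measurable_det) simp
  show ?thesis
    by (simp add: std_normal_density_vec_def)
qed

end

text \<open>The contributions of the equations other than \<open>k\<^sub>0\<close> to the Jacobian and to the density of the
  pivot coefficients.\<close>

definition rest_det ::
    "'n \<Rightarrow> ('n \<Rightarrow> 'b set) \<Rightarrow> ('n \<Rightarrow> 'b \<Rightarrow> real) \<Rightarrow> ('b \<Rightarrow> real ^ 'n) \<Rightarrow> ('n \<Rightarrow> 'b) \<Rightarrow> ('n \<times> 'b \<Rightarrow> real) \<Rightarrow> real ^ 'n \<Rightarrow> real ^ 'n \<Rightarrow> real"
  where
  "rest_det k\<^sub>0 A \<alpha> e q \<eta> y v =
     det (\<chi> k. if k = k\<^sub>0 then v else pivot_grad (A k) (\<alpha> k) e (q k) (\<lambda>b. \<eta> (k, b)) y)"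

definition rest_density ::
    "'n \<Rightarrow> ('n \<Rightarrow> 'b set) \<Rightarrow> ('n \<Rightarrow> 'b \<Rightarrow> real) \<Rightarrow> ('b \<Rightarrow> real ^ 'n) \<Rightarrow> ('n \<Rightarrow> 'b) \<Rightarrow> ('n \<times> 'b \<Rightarrow> real) \<Rightarrow> real ^ 'n \<Rightarrow> real"
  where
  "rest_density k\<^sub>0 A \<alpha> e q \<eta> y =
     (\<Prod>k\<in>-{k\<^sub>0}. std_normal_density (pivot_value (A k) (\<alpha> k) e (q k) (\<lambda>b. \<eta> (k, b)) y))"

lemma linear_rest_det: "linear (rest_det k\<^sub>0 A \<alpha> e q \<eta> y)"
  unfolding rest_det_def
  by (rule linearI) (simp_all only: det_row_add det_row_mul scalar_mult_eq_scaleR[symmetric] real_scaleR_def)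

lemma borel_measurable_rest_det:
  assumes c: "\<And>k b. k \<noteq> k\<^sub>0 \<Longrightarrow> b \<in> A k - {q k} \<Longrightarrow> (\<lambda>z. c z (k, b)) \<in> borel_measurable M"
    and y: "y \<in> borel_measurable M"
  shows "(\<lambda>z. rest_det k\<^sub>0 A \<alpha> e q (c z) (y z) v) \<in> borel_measurable M"
  unfolding rest_det_def
proof (rule borel_measurable_det)
  fix i j
  have "(\<lambda>z. pivot_grad (A i) (\<alpha> i) e (q i) (\<lambda>b. c z (i, b)) (y z)) \<in> borel_measurable M" if "i \<noteq> k\<^sub>0"
    by (rule borel_measurable_pivot_grad[OF c[OF that] y])
  then show "(\<lambda>z. (\<chi> k. if k = k\<^sub>0 then v else pivot_grad (A k) (\<alpha> k) e (q k) (\<lambda>b. c z (k, b)) (y z)) $ i $ j) \<in> borel_measurable M"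
    by (cases "i = k\<^sub>0") (simp_all add: borel_measurable_nth)
qed

lemma borel_measurable_rest_density:
  assumes c: "\<And>k b. k \<noteq> k\<^sub>0 \<Longrightarrow> b \<in> A k - {q k} \<Longrightarrow> (\<lambda>z. c z (k, b)) \<in> borel_measurable M"
    and y: "y \<in> borel_measurable M"
  shows "(\<lambda>z. rest_density k\<^sub>0 A \<alpha> e q (c z) (y z)) \<in> borel_measurable M"
  unfolding rest_density_def
proof (rule borel_measurable_prod)
  fix k assume "k \<in> - {k\<^sub>0}"
  then have "(\<lambda>z. pivot_value (A k) (\<alpha> k) e (q k) (\<lambda>b. c z (k, b)) (y z)) \<in> borel_measurable M"
    by (intro borel_measurable_pivot_value[OF _ y] c) auto
  then show "(\<lambda>z. std_normal_density (pivot_value (A k) (\<alpha> k) e (q k) (\<lambda>b. c z (k, b)) (y z))) \<in> borel_measurable M"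
    by measurable
qed

lemma borel_measurable_fst_component_std_gauss:
  assumes "j \<in> J"
  shows "(\<lambda>z. fst z j) \<in> borel_measurable (Pi\<^sub>M J (\<lambda>_. std_gauss) \<Otimes>\<^sub>M N)"
proof -
  have "(\<lambda>z. fst z j) \<in> measurable (Pi\<^sub>M J (\<lambda>_. std_gauss) \<Otimes>\<^sub>M N) std_gauss"
    by (rule measurable_compose[OF measurable_fst measurable_component_singleton[OF assms]])
  then show ?thesis by (simp cong: measurable_cong_sets)
qed

text \<open>At fixed y the coefficients of equation \<open>k\<^sub>0\<close> enter only through one
  row of the Jacobian and one pivot value, both linear in them, so they integrate out in closed
  form. The pivot \<open>q k\<^sub>0\<close> disappears from the result, and systems that differ
  only in equation \<open>k\<^sub>0\<close> differ only in the \<open>exp_var\<close>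
  factor.\<close>

theorem kac_rice:
  fixes A :: "'n::{finite,wellorder} \<Rightarrow> 'b set" and \<alpha> :: "'n \<Rightarrow> 'b \<Rightarrow> real"
    and e :: "'b \<Rightarrow> real ^ 'n::{finite,wellorder}" and q :: "'n \<Rightarrow> 'b"
  assumes A: "\<And>k. finite (A k)" "\<And>k. q k \<in> A k" "\<And>k b. b \<in> A k \<Longrightarrow> \<alpha> k b > 0"
    and V: "open V"
  shows "(\<integral>\<^sup>+c. ncard {y\<in>V. \<forall>k. exp_sum (A k) (\<alpha> k) e (\<lambda>b. c (k, b)) y = 0} \<partial>Pi\<^sub>M (Sigma UNIV A) (\<lambda>_. std_gauss)) =
    (\<integral>\<^sup>+\<eta>. \<integral>\<^sup>+y. gauss_abs_const * (ennreal (rest_density k\<^sub>0 A \<alpha> e q \<eta> y) * indicator V y) *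
        ennreal (sqrt (exp_var (A k\<^sub>0) (\<alpha> k\<^sub>0) e y (rest_det k\<^sub>0 A \<alpha> e q \<eta> y)))
      \<partial>lborel \<partial>Pi\<^sub>M (Sigma (-{k\<^sub>0}) (\<lambda>k. A k - {q k})) (\<lambda>_. std_gauss))"
proof -
  interpret product_sigma_finite "\<lambda>_. std_gauss" by (rule product_sigma_finite_std_gauss)
  define J' Jr J0 where "J' = Sigma UNIV (\<lambda>k. A k - {q k})" and "Jr = Sigma (-{k\<^sub>0}) (\<lambda>k. A k - {q k})"
    and "J0 = Pair k\<^sub>0 ` (A k\<^sub>0 - {q k\<^sub>0})"
  have J': "J' = Jr \<union> J0" by (auto simp: J'_def Jr_def J0_def)
  have fin: "finite Jr" "finite J0" "Jr \<inter> J0 = {}"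
    using A(1) by (auto simp: Jr_def J0_def)
  define I where "I \<eta> y = ennreal (\<bar>det (\<chi> k. pivot_grad (A k) (\<alpha> k) e (q k) (\<lambda>b. \<eta> (k, b)) y)\<bar> *
      std_normal_density_vec (\<chi> k. pivot_value (A k) (\<alpha> k) e (q k) (\<lambda>b. \<eta> (k, b)) y)) * indicator V y" for \<eta> y
  have I_meas: "(\<lambda>z. I (c z) (y z)) \<in> borel_measurable M"
    if "\<And>k b. b \<in> A k - {q k} \<Longrightarrow> (\<lambda>z. c z (k, b)) \<in> borel_measurable M" "y \<in> borel_measurable M"
    for c :: "'z \<Rightarrow> 'n \<times> 'b \<Rightarrow> real" and y M
    unfolding I_def by (rule borel_measurable_kac_rice_integrand[where A = A and q = q and \<alpha> = \<alpha> and c = c and y = y, OF A that]) (use V in auto)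
  note comp = borel_measurable_fst_component_std_gauss
  have "(\<lambda>z. I (fst z) (snd z)) \<in> borel_measurable (Pi\<^sub>M J' (\<lambda>_. std_gauss) \<Otimes>\<^sub>M lborel)"
    by (rule I_meas) (auto simp: J'_def intro!: comp)
  then have inner_meas: "(\<lambda>\<eta>. \<integral>\<^sup>+y. I \<eta> y \<partial>lborel) \<in> borel_measurable (Pi\<^sub>M J' (\<lambda>_. std_gauss))"
    by (intro lborel.borel_measurable_nn_integral) (simp add: case_prod_beta)
  have row: "(\<integral>\<^sup>+\<eta>0. I (merge Jr J0 (\<eta>, \<eta>0)) y \<partial>Pi\<^sub>M J0 (\<lambda>_. std_gauss)) =
      gauss_abs_const * (ennreal (rest_density k\<^sub>0 A \<alpha> e q \<eta> y) * indicator V y) *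
        ennreal (sqrt (exp_var (A k\<^sub>0) (\<alpha> k\<^sub>0) e y (rest_det k\<^sub>0 A \<alpha> e q \<eta> y)))" for \<eta> y
  proof -
    define L where "L = rest_det k\<^sub>0 A \<alpha> e q \<eta> y"
    \<comment> \<open>The coefficients of \<open>\<eta>0 j\<close> in the pivot value of row
      \<open>k\<^sub>0\<close> (v) and, by linearity of the determinant in that row, in the Jacobian
      (u).\<close>
    define v where "v = (\<lambda>j :: 'n \<times> 'b. pivot_weight (\<alpha> k\<^sub>0) e (q k\<^sub>0) (snd j) y)"
    define u where "u = (\<lambda>j :: 'n \<times> 'b. v j * L (e (snd j) - e (q k\<^sub>0)))"
    have L: "linear L" unfolding L_def by (rule linear_rest_det)
    have J0_sum: "(\<Sum>j\<in>J0. h j) = (\<Sum>b\<in>A k\<^sub>0 - {q k\<^sub>0}. h (k\<^sub>0, b))" for h :: "_ \<Rightarrow> real"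
      unfolding J0_def by (simp add: sum.reindex inj_on_def)
    have "I (merge Jr J0 (\<eta>, \<eta>0)) y = ennreal \<bar>\<Sum>j\<in>J0. \<eta>0 j * u j\<bar> * ennreal (std_normal_density (\<Sum>j\<in>J0. \<eta>0 j * v j)) *
        (ennreal (rest_density k\<^sub>0 A \<alpha> e q \<eta> y) * indicator V y)" for \<eta>0
    proof -
      have val: "pivot_value (A k) (\<alpha> k) e (q k) (\<lambda>b. merge Jr J0 (\<eta>, \<eta>0) (k, b)) y =
          (if k = k\<^sub>0 then \<Sum>j\<in>J0. \<eta>0 j * v j else pivot_value (A k) (\<alpha> k) e (q k) (\<lambda>b. \<eta> (k, b)) y)" for k
      proof (cases "k = k\<^sub>0")
        case True
        then show ?thesis
          unfolding J0_sum by (auto simp: pivot_value_def v_def merge_def Jr_def J0_def intro!: sum.cong)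
      next
        case False
        then show ?thesis
          by (auto simp: merge_def Jr_def intro!: pivot_value_cong split: if_splits)
      qed
      have grad: "pivot_grad (A k) (\<alpha> k) e (q k) (\<lambda>b. merge Jr J0 (\<eta>, \<eta>0) (k, b)) y =
          (if k = k\<^sub>0 then \<Sum>b\<in>A k\<^sub>0 - {q k\<^sub>0}. (\<eta>0 (k\<^sub>0, b) * v (k\<^sub>0, b)) *\<^sub>R (e b - e (q k\<^sub>0))
           else pivot_grad (A k) (\<alpha> k) e (q k) (\<lambda>b. \<eta> (k, b)) y)" for k
      proof (cases "k = k\<^sub>0")
        case True
        then show ?thesis
          by (auto simp: pivot_grad_def v_def merge_def Jr_def J0_def intro!: sum.cong)
      next
        case False
        then show ?thesis
          by (auto simp: merge_def Jr_def intro!: pivot_grad_cong split: if_splits)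
      qed
      have "det (\<chi> k. pivot_grad (A k) (\<alpha> k) e (q k) (\<lambda>b. merge Jr J0 (\<eta>, \<eta>0) (k, b)) y) =
          L (\<Sum>b\<in>A k\<^sub>0 - {q k\<^sub>0}. (\<eta>0 (k\<^sub>0, b) * v (k\<^sub>0, b)) *\<^sub>R (e b - e (q k\<^sub>0)))"
        unfolding L_def rest_det_def grad ..
      also have "\<dots> = (\<Sum>j\<in>J0. \<eta>0 j * u j)"
        unfolding J0_sum by (simp add: linear_sum[OF L] linear_scale[OF L] u_def mult.assoc)
      finally have det: "det (\<chi> k. pivot_grad (A k) (\<alpha> k) e (q k) (\<lambda>b. merge Jr J0 (\<eta>, \<eta>0) (k, b)) y) = (\<Sum>j\<in>J0. \<eta>0 j * u j)" .
      have "std_normal_density_vec (\<chi> k. pivot_value (A k) (\<alpha> k) e (q k) (\<lambda>b. merge Jr J0 (\<eta>, \<eta>0) (k, b)) y) =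
          (\<Prod>k\<in>UNIV. std_normal_density (if k = k\<^sub>0 then \<Sum>j\<in>J0. \<eta>0 j * v j else pivot_value (A k) (\<alpha> k) e (q k) (\<lambda>b. \<eta> (k, b)) y))"
        unfolding std_normal_density_vec_def val by simp
      also have "\<dots> = std_normal_density (\<Sum>j\<in>J0. \<eta>0 j * v j) * rest_density k\<^sub>0 A \<alpha> e q \<eta> y"
        unfolding rest_density_def
        by (subst prod.remove[of UNIV k\<^sub>0]) (auto simp: Compl_eq_Diff_UNIV intro!: prod.cong)
      finally show ?thesis
        unfolding I_def det by (simp add: ennreal_mult rest_density_def prod_nonneg mult.assoc)
    qed
    then have "(\<integral>\<^sup>+\<eta>0. I (merge Jr J0 (\<eta>, \<eta>0)) y \<partial>Pi\<^sub>M J0 (\<lambda>_. std_gauss)) =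
        (\<integral>\<^sup>+\<eta>0. ennreal \<bar>\<Sum>j\<in>J0. \<eta>0 j * u j\<bar> * ennreal (std_normal_density (\<Sum>j\<in>J0. \<eta>0 j * v j)) *
        (ennreal (rest_density k\<^sub>0 A \<alpha> e q \<eta> y) * indicator V y) \<partial>Pi\<^sub>M J0 (\<lambda>_. std_gauss))"
      by (simp only:)
    also have "\<dots> = (\<integral>\<^sup>+\<eta>0. ennreal \<bar>\<Sum>j\<in>J0. \<eta>0 j * u j\<bar> * ennreal (std_normal_density (\<Sum>j\<in>J0. \<eta>0 j * v j)) \<partial>Pi\<^sub>M J0 (\<lambda>_. std_gauss)) *
        (ennreal (rest_density k\<^sub>0 A \<alpha> e q \<eta> y) * indicator V y)"
      by (rule nn_integral_multc) measurable
    also have "\<dots> = gauss_abs_const * ennreal (sqrt (exp_var (A k\<^sub>0) (\<alpha> k\<^sub>0) e y L)) *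
        (ennreal (rest_density k\<^sub>0 A \<alpha> e q \<eta> y) * indicator V y)"
    proof -
      have "(\<Sum>j\<in>J0. (u j)\<^sup>2) / (1 + (\<Sum>j\<in>J0. (v j)\<^sup>2)) - ((\<Sum>j\<in>J0. u j * v j) / (1 + (\<Sum>j\<in>J0. (v j)\<^sup>2)))\<^sup>2 =
          exp_var (A k\<^sub>0) (\<alpha> k\<^sub>0) e y L"
        using exp_var_pivot[where A = "A k\<^sub>0" and q = "q k\<^sub>0" and \<alpha> = "\<alpha> k\<^sub>0" and L = L and e = e and y = y, OF A(1) A(2) A(3) L]
        unfolding J0_sum by (simp add: u_def v_def)
      then show ?thesis
        unfolding nn_integral_gauss_abs_density[OF fin(2)] by (simp only:)
    qed
    finally show ?thesis
      by (simp add: L_def mult_ac)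
  qed
  have "(\<integral>\<^sup>+c. ncard {y\<in>V. \<forall>k. exp_sum (A k) (\<alpha> k) e (\<lambda>b. c (k, b)) y = 0} \<partial>Pi\<^sub>M (Sigma UNIV A) (\<lambda>_. std_gauss)) =
      (\<integral>\<^sup>+\<eta>. \<integral>\<^sup>+y. I \<eta> y \<partial>lborel \<partial>Pi\<^sub>M J' (\<lambda>_. std_gauss))"
    unfolding I_def J'_def by (rule nn_integral_ncard_exp_sum[OF A V])
  also have "\<dots> = (\<integral>\<^sup>+\<eta>. \<integral>\<^sup>+\<eta>0. \<integral>\<^sup>+y. I (merge Jr J0 (\<eta>, \<eta>0)) y \<partial>lborel \<partial>Pi\<^sub>M J0 (\<lambda>_. std_gauss) \<partial>Pi\<^sub>M Jr (\<lambda>_. std_gauss))"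
    unfolding J' by (rule product_nn_integral_fold[OF fin(3,1,2) inner_meas[unfolded J']])
  \<comment> \<open>Fubini moves the integral over y outside, so that the coefficients of the row
    are integrated at a fixed point, as in \<open>row\<close>.\<close>
  also have "\<dots> = (\<integral>\<^sup>+\<eta>. \<integral>\<^sup>+y. \<integral>\<^sup>+\<eta>0. I (merge Jr J0 (\<eta>, \<eta>0)) y \<partial>Pi\<^sub>M J0 (\<lambda>_. std_gauss) \<partial>lborel \<partial>Pi\<^sub>M Jr (\<lambda>_. std_gauss))"
  proof (rule nn_integral_cong)
    fix \<eta> :: "'n \<times> 'b \<Rightarrow> real"
    interpret J0: sigma_finite_measure "Pi\<^sub>M J0 (\<lambda>_. std_gauss)"
      by (rule sigma_finite[OF fin(2)])
    interpret JL: pair_sigma_finite "Pi\<^sub>M J0 (\<lambda>_. std_gauss)" "lborel :: (real ^ 'n::_) measure" ..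
    have "(\<lambda>z. I (merge Jr J0 (\<eta>, fst z)) (snd z)) \<in> borel_measurable (Pi\<^sub>M J0 (\<lambda>_. std_gauss) \<Otimes>\<^sub>M lborel)"
    proof (rule I_meas)
      fix k b assume b: "b \<in> A k - {q k}"
      show "(\<lambda>z. merge Jr J0 (\<eta>, fst z) (k, b)) \<in> borel_measurable (Pi\<^sub>M J0 (\<lambda>_. std_gauss) \<Otimes>\<^sub>M lborel)"
      proof (cases "k = k\<^sub>0")
        case True
        then show ?thesis
          using b comp[of "(k, b)" J0 lborel] by (simp add: merge_def Jr_def J0_def)
      next
        case False
        then show ?thesis
          using b by (simp add: merge_def Jr_def)
      qed
    qed measurable
    then show "(\<integral>\<^sup>+\<eta>0. \<integral>\<^sup>+y. I (merge Jr J0 (\<eta>, \<eta>0)) y \<partial>lborel \<partial>Pi\<^sub>M J0 (\<lambda>_. std_gauss)) =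
        (\<integral>\<^sup>+y. \<integral>\<^sup>+\<eta>0. I (merge Jr J0 (\<eta>, \<eta>0)) y \<partial>Pi\<^sub>M J0 (\<lambda>_. std_gauss) \<partial>lborel)"
      by (intro JL.Fubini'[symmetric]) (simp add: case_prod_beta)
  qed
  finally show ?thesis
    unfolding row unfolding Jr_def .
qed

section \<open>Arbitrary finite index types\<close>

text \<open>The change of variables theorem of the library requires a well-ordered index type. The type
  below is a copy of the index type \<open>'a\<close> with a well-order.\<close>

typedef (overloaded) 'a ordered_index = "{..<CARD('a::finite)}"
  by (rule exI[of _ 0]) simp

instantiation ordered_index :: (finite) wellorder
begin

definition "x \<le> y \<longleftrightarrow> Rep_ordered_index x \<le> Rep_ordered_index y"
definition "x < y \<longleftrightarrow> Rep_ordered_index x < Rep_ordered_index y"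

instance
proof
  fix P :: "'a ordered_index \<Rightarrow> bool" and a
  assume *: "\<And>x. (\<And>y. y < x \<Longrightarrow> P y) \<Longrightarrow> P x"
  show "P a"
    by (induction "Rep_ordered_index a" arbitrary: a rule: less_induct) (rule *, simp add: less_ordered_index_def)
qed (auto simp: less_eq_ordered_index_def less_ordered_index_def Rep_ordered_index_inject)

end

lemma bij_betw_Rep_ordered_index: "bij_betw Rep_ordered_index (UNIV :: 'a::finite ordered_index set) {..<CARD('a)}"
  using type_definition.Rep_range[OF type_definition_ordered_index]
  by (auto simp: bij_betw_def inj_on_def Rep_ordered_index_inject)

instance ordered_index :: (finite) finite
  using bij_betw_finite[OF bij_betw_Rep_ordered_index] by (intro_classes) simp

lemma card_ordered_index: "CARD('a::finite ordered_index) = CARD('a)"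
  using bij_betw_same_card[OF bij_betw_Rep_ordered_index] by simp

definition unordered_index :: "'a::finite ordered_index \<Rightarrow> 'a" where
  "unordered_index = (SOME f. bij f)"

lemma bij_unordered_index: "bij (unordered_index :: 'a::finite ordered_index \<Rightarrow> 'a)"
proof -
  have "\<exists>f :: 'a ordered_index \<Rightarrow> 'a. bij f"
    using finite_same_card_bij[of "UNIV :: 'a ordered_index set" "UNIV :: 'a set"]
    by (auto simp: card_ordered_index)
  then show ?thesis
    unfolding unordered_index_def by (rule someI_ex)
qed

text \<open>A relabelling of coordinates, hence a linear isometry: exponential sums keep their
  values when exponents and points are moved together, and zeros correspond one to one.\<close>

definition order_coords :: "real ^ 'm \<Rightarrow> real ^ 'm::finite ordered_index" where
  "order_coords x = (\<chi> j. x $ unordered_index j)"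

lemma linear_order_coords: "linear order_coords"
  by (rule linearI) (simp_all add: order_coords_def vec_eq_iff)

lemma inner_order_coords: "order_coords x \<bullet> order_coords y = x \<bullet> y"
  unfolding inner_vec_def order_coords_def
  using sum.reindex_bij_betw[OF bij_unordered_index, of "\<lambda>i. x $ i \<bullet> y $ i"] by simp

lemma inj_order_coords: "inj order_coords"
proof (rule injI)
  fix x y :: "real ^ 'm" assume "order_coords x = order_coords y"
  then have "order_coords (x - y) \<bullet> order_coords (x - y) = 0"
    by (simp add: linear_diff[OF linear_order_coords])
  then show "x = y"
    by (simp add: inner_order_coords)
qed

lemma open_order_coords_image:
  assumes "open U"
  shows "open (order_coords ` U)"
proof -
  define w :: "real ^ 'a ordered_index \<Rightarrow> real ^ 'a" where "w y = (\<chi> i. y $ inv unordered_index i)" for y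
  have "order_coords (w y) = y" for y
    by (simp add: order_coords_def w_def vec_eq_iff bij_is_inj[OF bij_unordered_index])
  moreover have "w (order_coords x) = x" for x
    by (simp add: order_coords_def w_def vec_eq_iff bij_is_surj[OF bij_unordered_index] surj_f_inv_f)
  ultimately have "order_coords ` U = w -` U"
    by (metis (no_types, lifting) image_subset_iff subsetI subset_antisym vimageE vimageI imageI)
  moreover have "continuous_on UNIV w"
    unfolding w_def by (intro continuous_on_vec_lambda continuous_intros)
  ultimately show ?thesis
    using assms open_vimage by metis
qed

lemma ncard_image:
  assumes "inj_on f S"
  shows "ncard (f ` S) = ncard S"
  using assms by (cases "finite S") (simp_all add: card_image finite_image_iff)

lemma (in prob_space) indep_vars_reindex:
  assumes f: "inj_on f K" and X: "indep_vars (\<lambda>_. N) X (f ` K)"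
  shows "indep_vars (\<lambda>_. N) (\<lambda>k. X (f k)) K"
proof -
  have meas: "X (f k) \<in> measurable M N" if "k \<in> K" for k
    using X that by (auto simp: indep_vars_def2)
  have "prob (\<Inter>j\<in>J. B j) = (\<Prod>j\<in>J. prob (B j))"
    if J: "J \<subseteq> K" "J \<noteq> {}" "finite J" and B: "\<forall>j\<in>J. \<exists>A. B j = X (f j) -` A \<inter> space M \<and> A \<in> sets N" for J B
  proof -
    define B' where "B' i = B (inv_into K f i)" for i
    have B': "B' (f j) = B j" if "j \<in> J" for j
      using that J(1) f by (simp add: B'_def inv_into_f_f subset_iff)
    have "prob (\<Inter>i\<in>f ` J. B' i) = (\<Prod>i\<in>f ` J. prob (B' i))"
    proof (rule indep_setsD)
      show "indep_sets (\<lambda>i. {X i -` A \<inter> space M |A. A \<in> sets N}) (f ` K)"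
        using X by (simp add: indep_vars_def2)
      show "\<forall>i\<in>f ` J. B' i \<in> {X i -` A \<inter> space M |A. A \<in> sets N}"
        using B B' by auto
    qed (use J in auto)
    then show ?thesis
      using inj_on_subset[OF f J(1)] B' by (simp add: prod.reindex)
  qed
  then show ?thesis
    using meas unfolding indep_vars_def2 indep_sets_def by (auto simp: Pi_iff intro: measurable_sets)
qed

section \<open>The variance of the random exponent: positivity and additivity\<close>

text \<open>Cauchy-Schwarz for the square roots of the weights. If the total weight is 0, both
  quotients are 0 by the convention for division by zero.\<close>

lemma exp_var_nonneg: "0 \<le> exp_var A \<alpha> e y L"
proof -
  let ?K = "exp_moment A \<alpha> e y L"
  have "(?K 1)\<^sup>2 \<le> ?K 0 * ?K 2"
    using Cauchy_Schwarz_ineq_sum[of "\<lambda>b. \<alpha> b * exp (e b \<bullet> y)" "\<lambda>b. \<alpha> b * exp (e b \<bullet> y) * L (e b)" A]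
    by (simp add: exp_moment_def power_mult_distrib power2_eq_square mult_ac)
  moreover have "?K 0 \<ge> 0"
    unfolding exp_moment_def by (intro sum_nonneg) simp
  ultimately have "?K 2 / ?K 0 \<ge> (?K 1 / ?K 0)\<^sup>2"
    by (cases "?K 0 = 0") (auto simp: power_divide power2_eq_square field_simps)
  then show ?thesis
    by (simp add: exp_var_def)
qed

text \<open>The variances add because \<open>A + B\<close>, weighted by the squared Aronszajn terms, is the
  distribution of the sum of two independent random exponents.\<close>

lemma exp_var_aronszajn:
  fixes A B :: "(real ^ 'm) set"
  assumes A: "finite A" "A \<noteq> {}" "\<And>a. a \<in> A \<Longrightarrow> \<alpha> a > 0"
    and B: "finite B" "B \<noteq> {}" "\<And>b. b \<in> B \<Longrightarrow> \<beta> b > 0"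
    and e: "linear e" and L: "linear L"
  shows "exp_var (A + B) (aronszajn_coeff A \<alpha> B \<beta>) e y L = exp_var A \<alpha> e y L + exp_var B \<beta> e y L"
proof -
  let ?C = "exp_moment (A + B) (aronszajn_coeff A \<alpha> B \<beta>) e y L"
  let ?K = "exp_moment A \<alpha> e y L" and ?K' = "exp_moment B \<beta> e y L"
  define u where "u a = (\<alpha> a * exp (e a \<bullet> y))\<^sup>2" for a
  define v where "v b = (\<beta> b * exp (e b \<bullet> y))\<^sup>2" for b
  have C: "?C r = (\<Sum>a\<in>A. \<Sum>b\<in>B. u a * v b * (L (e a) + L (e b)) ^ r)" for r
  proof -
    have fin: "finite (A + B)" "finite (A \<times> B)" using A B by (auto simp: set_plus_image)
    have "?C r = (\<Sum>c\<in>A + B. \<Sum>p\<in>{p\<in>A \<times> B. fst p + snd p = c}. u (fst p) * v (snd p) * (L (e (fst p)) + L (e (snd p))) ^ r)"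
      unfolding exp_moment_def
    proof (rule sum.cong[OF refl])
      fix c assume "c \<in> A + B"
      have "(aronszajn_coeff A \<alpha> B \<beta> c)\<^sup>2 = (\<Sum>p\<in>{p\<in>A \<times> B. fst p + snd p = c}. (\<alpha> (fst p))\<^sup>2 * (\<beta> (snd p))\<^sup>2)"
      proof -
        have "{(a, b). a \<in> A \<and> b \<in> B \<and> a + b = c} = {p\<in>A \<times> B. fst p + snd p = c}" by auto
        then show ?thesis
          by (simp add: aronszajn_coeff_def case_prod_beta sum_nonneg)
      qed
      then have "(aronszajn_coeff A \<alpha> B \<beta> c * exp (e c \<bullet> y))\<^sup>2 * L (e c) ^ r =
          (\<Sum>p\<in>{p\<in>A \<times> B. fst p + snd p = c}. (\<alpha> (fst p))\<^sup>2 * (\<beta> (snd p))\<^sup>2 * (exp (e c \<bullet> y))\<^sup>2 * L (e c) ^ r)"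
        by (simp add: power_mult_distrib sum_distrib_right)
      also have "\<dots> = (\<Sum>p\<in>{p\<in>A \<times> B. fst p + snd p = c}. u (fst p) * v (snd p) * (L (e (fst p)) + L (e (snd p))) ^ r)"
      proof (rule sum.cong[OF refl])
        fix p assume "p \<in> {p\<in>A \<times> B. fst p + snd p = c}"
        then have c: "c = fst p + snd p" by simp
        show "(\<alpha> (fst p))\<^sup>2 * (\<beta> (snd p))\<^sup>2 * (exp (e c \<bullet> y))\<^sup>2 * L (e c) ^ r =
            u (fst p) * v (snd p) * (L (e (fst p)) + L (e (snd p))) ^ r"
          by (simp add: c u_def v_def linear_add[OF e] linear_add[OF L] inner_add_left exp_add power_mult_distrib)
      qed
      finally show "(aronszajn_coeff A \<alpha> B \<beta> c * exp (e c \<bullet> y))\<^sup>2 * L (e c) ^ r =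
          (\<Sum>p\<in>{p\<in>A \<times> B. fst p + snd p = c}. u (fst p) * v (snd p) * (L (e (fst p)) + L (e (snd p))) ^ r)" .
    qed
    \<comment> \<open>The pairs were grouped by their sum: the square of an Aronszajn coefficient
      collects exactly one such group.\<close>
    also have "\<dots> = (\<Sum>p\<in>A \<times> B. u (fst p) * v (snd p) * (L (e (fst p)) + L (e (snd p))) ^ r)"
      using fin by (intro sum.group) (auto intro: set_plus_intro)
    also have "\<dots> = (\<Sum>a\<in>A. \<Sum>b\<in>B. u a * v b * (L (e a) + L (e b)) ^ r)"
      unfolding sum.cartesian_product by (simp add: case_prod_beta)
    finally show ?thesis .
  qed
  have K: "?K r = (\<Sum>a\<in>A. u a * L (e a) ^ r)" and K': "?K' r = (\<Sum>b\<in>B. v b * L (e b) ^ r)" for r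
    by (simp_all add: exp_moment_def u_def v_def)
  have prod: "?K r * ?K' r' = (\<Sum>a\<in>A. \<Sum>b\<in>B. u a * v b * (L (e a) ^ r * L (e b) ^ r'))" for r r'
    unfolding K K' sum_product by (simp add: mult_ac)
  have C0: "?C 0 = ?K 0 * ?K' 0"
    unfolding C prod by simp
  have C1: "?C 1 = ?K 1 * ?K' 0 + ?K 0 * ?K' 1"
    unfolding C prod sum.distrib[symmetric] by (simp add: algebra_simps)
  \<comment> \<open>The cross term matches the one in the square of the sum of the two means, so it
    cancels in the variance.\<close>
  have C2: "?C 2 = ?K 2 * ?K' 0 + 2 * (?K 1 * ?K' 1) + ?K 0 * ?K' 2"
    unfolding C prod sum_distrib_left sum.distrib[symmetric]
    by (intro sum.cong) (auto simp: power2_eq_square algebra_simps)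
  have pos: "?K 0 > 0" "?K' 0 > 0"
    using A B by (auto intro!: exp_moment_0_pos)
  have "?C 2 / ?C 0 = ?K 2 / ?K 0 + 2 * (?K 1 / ?K 0) * (?K' 1 / ?K' 0) + ?K' 2 / ?K' 0"
    unfolding C0 C2 using pos by (simp add: field_simps)
  moreover have "?C 1 / ?C 0 = ?K 1 / ?K 0 + ?K' 1 / ?K' 0"
    unfolding C0 C1 using pos by (simp add: field_simps)
  ultimately show ?thesis
    unfolding exp_var_def by (simp only:) (simp add: power2_eq_square algebra_simps)
qed

section \<open>Expected numbers of zeros\<close>

text \<open>The rest terms look only at rows other than \<open>k\<^sub>0\<close>, so exchanging the
  distinguished equation leaves them, and the measure they are integrated against,
  unchanged.\<close>

lemma rest_cong:
  assumes "\<And>k. k \<noteq> k\<^sub>0 \<Longrightarrow> A k = A' k" "\<And>k. k \<noteq> k\<^sub>0 \<Longrightarrow> \<alpha> k = \<alpha>' k" "\<And>k. k \<noteq> k\<^sub>0 \<Longrightarrow> q k = q' k"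
  shows "rest_density k\<^sub>0 A \<alpha> e q = rest_density k\<^sub>0 A' \<alpha>' e q'"
    and "rest_det k\<^sub>0 A \<alpha> e q = rest_det k\<^sub>0 A' \<alpha>' e q'"
    and "Sigma (-{k\<^sub>0}) (\<lambda>k. A k - {q k}) = Sigma (-{k\<^sub>0}) (\<lambda>k. A' k - {q' k})"
proof -
  show "rest_density k\<^sub>0 A \<alpha> e q = rest_density k\<^sub>0 A' \<alpha>' e q'"
    unfolding rest_density_def using assms by (intro ext prod.cong) auto
  have "(if k = k\<^sub>0 then v else pivot_grad (A k) (\<alpha> k) e (q k) c y) =
      (if k = k\<^sub>0 then v else pivot_grad (A' k) (\<alpha>' k) e (q' k) c y)" for k v c y
    using assms[of k] by simp
  then show "rest_det k\<^sub>0 A \<alpha> e q = rest_det k\<^sub>0 A' \<alpha>' e q'"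
    unfolding rest_det_def by (simp only:)
  show "Sigma (-{k\<^sub>0}) (\<lambda>k. A k - {q k}) = Sigma (-{k\<^sub>0}) (\<lambda>k. A' k - {q' k})"
    using assms by (intro Sigma_cong) auto
qed

lemma gaussian_exp_sum_nonempty:
  fixes A :: "(real ^ 'm) set"
  assumes "gaussian_exp_sum M A \<alpha> F"
  shows "A \<noteq> {}"
proof
  assume "A = {}"
  then have "aff_dim (convex hull A) = -1" by simp
  then show False using assms by (simp add: gaussian_exp_sum_def)
qed

text \<open>Passage to coefficient space: \<open>order_coords\<close> is injective and so preserves
  the number of zeros, and all coefficients together are independent standard Gaussians. The index
  set \<open>{..<CARD('m)}\<close> is matched with the ordered type by
  \<open>Rep_ordered_index\<close>.\<close>

lemma expected_zeros_eq_nn_integral_coefficients: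
  fixes A U :: "(real ^ 'm) set" and As :: "nat \<Rightarrow> (real ^ 'm) set"
    and \<alpha> :: "real ^ 'm \<Rightarrow> real" and \<alpha>s :: "nat \<Rightarrow> real ^ 'm \<Rightarrow> real"
  defines "A' \<equiv> \<lambda>k :: 'm ordered_index. (As(0 := A)) (Rep_ordered_index k)"
    and "\<alpha>' \<equiv> \<lambda>k :: 'm ordered_index. (\<alpha>s(0 := \<alpha>)) (Rep_ordered_index k)"
  assumes M: "prob_space M" and F: "gaussian_exp_sum M A \<alpha> F"
    and Fs: "\<And>i. i \<in> {1..<CARD('m)} \<Longrightarrow> gaussian_exp_sum M (As i) (\<alpha>s i) (Fs i)"
    and indep: "indep_random_functions M {..<CARD('m)} (adjoin F Fs)"
    and U: "open U"
  shows "expected_zeros M {..<CARD('m)} (adjoin F Fs) U =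
    (\<integral>\<^sup>+c. ncard {y\<in>order_coords ` U. \<forall>k. exp_sum (A' k) (\<alpha>' k) order_coords (\<lambda>b. c (k, b)) y = 0}
      \<partial>Pi\<^sub>M (Sigma UNIV A') (\<lambda>_. std_gauss))"
proof -
  interpret prob_space M by fact
  let ?R = "Rep_ordered_index :: 'm ordered_index \<Rightarrow> nat"
  have R_lt: "?R k < CARD('m)" for k
    using Rep_ordered_index[of k] by simp
  have G: "gaussian_exp_sum M (A' k) (\<alpha>' k) (adjoin F Fs (?R k))" for k
    using F Fs[of "?R k"] R_lt[of k] by (auto simp: A'_def \<alpha>'_def adjoin_def)
  then have A': "finite (A' k)" "A' k \<noteq> {}" "b \<in> A' k \<Longrightarrow> \<alpha>' k b > 0" for k b
    using gaussian_exp_sum_nonempty[OF G, of k] unfolding gaussian_exp_sum_def by blast+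
  have "\<forall>k. \<exists>\<xi> :: real ^ 'm \<Rightarrow> 'a \<Rightarrow> real. indep_vars (\<lambda>_. borel) \<xi> (A' k) \<and>
      (\<forall>a\<in>A' k. distributed M lborel (\<xi> a) (\<lambda>t. ennreal (std_normal_density t))) \<and>
      (\<forall>\<omega>\<in>space M. \<forall>x. adjoin F Fs (?R k) \<omega> x = (\<Sum>a\<in>A' k. \<xi> a \<omega> * \<alpha>' k a * exp (a \<bullet> x)))"
    using G unfolding gaussian_exp_sum_def by blast
  then obtain \<xi> where \<xi>: "\<forall>k. indep_vars (\<lambda>_. borel) (\<xi> k) (A' k) \<and>
      (\<forall>a\<in>A' k. distributed M lborel (\<xi> k a) (\<lambda>t. ennreal (std_normal_density t))) \<and>
      (\<forall>\<omega>\<in>space M. \<forall>x. adjoin F Fs (?R k) \<omega> x = (\<Sum>a\<in>A' k. \<xi> k a \<omega> * \<alpha>' k a * exp (a \<bullet> x)))"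
    unfolding choice_iff by (elim exE)
  have indep': "indep_vars (\<lambda>_. Pi\<^sub>M UNIV (\<lambda>_. borel)) (\<lambda>k. adjoin F Fs (?R k)) UNIV"
  proof (rule indep_vars_reindex)
    show "inj ?R" "indep_vars (\<lambda>_. Pi\<^sub>M UNIV (\<lambda>_. borel)) (adjoin F Fs) (range ?R)"
      using bij_betw_Rep_ordered_index[where 'a = 'm] indep by (auto simp: bij_betw_def indep_random_functions_def)
  qed
  let ?X = "\<lambda>\<omega>. \<lambda>j\<in>Sigma UNIV A'. \<xi> (fst j) (snd j) \<omega>"
  let ?h = "\<lambda>c. ncard {y\<in>order_coords ` U. \<forall>k. exp_sum (A' k) (\<alpha>' k) order_coords (\<lambda>b. c (k, b)) y = 0}"
  have law: "distr M (Pi\<^sub>M (Sigma UNIV A') (\<lambda>_. borel)) ?X = Pi\<^sub>M (Sigma UNIV A') (\<lambda>_. std_gauss)"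
    and \<xi>_meas: "a \<in> A' k \<Longrightarrow> \<xi> k a \<in> borel_measurable M" for k a
    using distr_coefficients_eq_PiM[of M UNIV A' \<alpha>' \<xi> "\<lambda>k. adjoin F Fs (?R k)"] A' \<xi> M indep' by auto
  define Z where "Z \<omega> k = exp_sum (A' k) (\<alpha>' k) order_coords (\<lambda>b. ?X \<omega> (k, b))" for \<omega> k
  have "adjoin F Fs (?R k) \<omega> x = Z \<omega> k (order_coords x)" if "\<omega> \<in> space M" for k \<omega> x
    using \<xi>[THEN spec, of k] that by (auto simp: Z_def exp_sum_def inner_order_coords intro!: sum.cong)
  moreover have "(\<forall>i\<in>{..<CARD('m)}. P i) \<longleftrightarrow> (\<forall>k. P (?R k))" for P
    by (simp flip: bij_betw_imp_surj_on[OF bij_betw_Rep_ordered_index[where 'a = 'm]])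
  ultimately have "common_zeros {..<CARD('m)} (\<lambda>i. adjoin F Fs i \<omega>) U = {x\<in>U. \<forall>k. Z \<omega> k (order_coords x) = 0}"
    if "\<omega> \<in> space M" for \<omega>
    using that by (simp add: common_zeros_def)
  then have "order_coords ` common_zeros {..<CARD('m)} (\<lambda>i. adjoin F Fs i \<omega>) U =
      {y\<in>order_coords ` U. \<forall>k. exp_sum (A' k) (\<alpha>' k) order_coords (\<lambda>b. ?X \<omega> (k, b)) y = 0}" if "\<omega> \<in> space M" for \<omega>
    using that unfolding Z_def[symmetric] by auto
  then have "expected_zeros M {..<CARD('m)} (adjoin F Fs) U = (\<integral>\<^sup>+\<omega>. ?h (?X \<omega>) \<partial>M)"
    unfolding expected_zeros_def
    by (intro nn_integral_cong) (metis (no_types, lifting) ncard_image inj_order_coords inj_on_subset subset_UNIV)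
  also have "\<dots> = (\<integral>\<^sup>+c. ?h c \<partial>distr M (Pi\<^sub>M (Sigma UNIV A') (\<lambda>_. borel)) ?X)"
  proof (rule nn_integral_distr[symmetric])
    show "?X \<in> measurable M (Pi\<^sub>M (Sigma UNIV A') (\<lambda>_. borel))"
      by (rule measurable_restrict) (auto intro: \<xi>_meas)
    \<comment> \<open>Any element of a support may serve as its pivot; supports are nonempty by full
      dimension.\<close>
    show "?h \<in> borel_measurable (distr M (Pi\<^sub>M (Sigma UNIV A') (\<lambda>_. borel)) ?X)"
      using borel_measurable_ncard_exp_sum[of A' "\<lambda>k. SOME b. b \<in> A' k" \<alpha>' "order_coords ` U" "\<lambda>c. c"]
        A' open_order_coords_image[OF U] by (simp add: some_in_eq)
  qed
  finally show ?thesis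
    unfolding law .
qed

text \<open>The families on the right are those before the update at 0, since the rest terms read
  only rows other than \<open>k\<^sub>0\<close>. In this form the right-hand sides for two
  distinguished functions differ in A and \<alpha> alone; even the integration measure is the
  same.\<close>

lemma expected_zeros_kac_rice:
  fixes A U :: "(real ^ 'm) set" and As :: "nat \<Rightarrow> (real ^ 'm) set"
    and \<alpha> :: "real ^ 'm \<Rightarrow> real" and \<alpha>s :: "nat \<Rightarrow> real ^ 'm \<Rightarrow> real"
  defines "k\<^sub>0 \<equiv> Abs_ordered_index 0 :: 'm ordered_index"
    and "A' \<equiv> \<lambda>k :: 'm ordered_index. As (Rep_ordered_index k)"
    and "\<alpha>' \<equiv> \<lambda>k :: 'm ordered_index. \<alpha>s (Rep_ordered_index k)"
    and "q \<equiv> \<lambda>k :: 'm ordered_index. SOME a. a \<in> As (Rep_ordered_index k)"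
  assumes M: "prob_space M" and F: "gaussian_exp_sum M A \<alpha> F"
    and Fs: "\<And>i. i \<in> {1..<CARD('m)} \<Longrightarrow> gaussian_exp_sum M (As i) (\<alpha>s i) (Fs i)"
    and indep: "indep_random_functions M {..<CARD('m)} (adjoin F Fs)"
    and U: "open U"
  shows "expected_zeros M {..<CARD('m)} (adjoin F Fs) U =
    (\<integral>\<^sup>+\<eta>. \<integral>\<^sup>+y. gauss_abs_const *
        (ennreal (rest_density k\<^sub>0 A' \<alpha>' order_coords q \<eta> y) * indicator (order_coords ` U) y) *
        ennreal (sqrt (exp_var A \<alpha> order_coords y (rest_det k\<^sub>0 A' \<alpha>' order_coords q \<eta> y)))
      \<partial>lborel \<partial>Pi\<^sub>M (Sigma (-{k\<^sub>0}) (\<lambda>k. A' k - {q k})) (\<lambda>_. std_gauss))"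
proof -
  let ?R = "Rep_ordered_index :: 'm ordered_index \<Rightarrow> nat"
  have R_k\<^sub>0: "?R k\<^sub>0 = 0"
    unfolding k\<^sub>0_def by (simp add: Abs_ordered_index_inverse)
  have R_eq_0: "?R k = 0 \<longleftrightarrow> k = k\<^sub>0" for k
    using R_k\<^sub>0 Rep_ordered_index_inject[of k k\<^sub>0] by auto
  define AA where "AA k = (As(0 := A)) (?R k)" for k
  define \<alpha>\<alpha> where "\<alpha>\<alpha> k = (\<alpha>s(0 := \<alpha>)) (?R k)" for k
  define qq where "qq k = (SOME a. a \<in> AA k)" for k
  have G: "gaussian_exp_sum M (AA k) (\<alpha>\<alpha> k) (adjoin F Fs (?R k))" for k
    using F Fs[of "?R k"] Rep_ordered_index[of k] by (auto simp: AA_def \<alpha>\<alpha>_def adjoin_def)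
  then have AA: "finite (AA k)" "b \<in> AA k \<Longrightarrow> \<alpha>\<alpha> k b > 0" for k b
    unfolding gaussian_exp_sum_def by blast+
  have qq: "qq k \<in> AA k" for k
    unfolding qq_def using gaussian_exp_sum_nonempty[OF G] by (simp add: some_in_eq)
  have AA_k\<^sub>0: "AA k\<^sub>0 = A" "\<alpha>\<alpha> k\<^sub>0 = \<alpha>"
    by (simp_all add: AA_def \<alpha>\<alpha>_def R_k\<^sub>0)
  have other: "AA k = A' k" "\<alpha>\<alpha> k = \<alpha>' k" "qq k = q k" if "k \<noteq> k\<^sub>0" for k
    using that R_eq_0[of k] by (simp_all add: qq_def AA_def \<alpha>\<alpha>_def A'_def \<alpha>'_def q_def)
  have "expected_zeros M {..<CARD('m)} (adjoin F Fs) U =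
    (\<integral>\<^sup>+c. ncard {y\<in>order_coords ` U. \<forall>k. exp_sum (AA k) (\<alpha>\<alpha> k) order_coords (\<lambda>b. c (k, b)) y = 0}
      \<partial>Pi\<^sub>M (Sigma UNIV AA) (\<lambda>_. std_gauss))"
    using expected_zeros_eq_nn_integral_coefficients[OF M F Fs indep U]
    unfolding AA_def[abs_def] \<alpha>\<alpha>_def[abs_def] .
  also note kac_rice[where k\<^sub>0 = k\<^sub>0 and A = AA and q = qq and \<alpha> = \<alpha>\<alpha> and e = order_coords,
    OF AA(1) qq AA(2) open_order_coords_image[OF U]]
  also note rest_cong(1)[where k\<^sub>0 = k\<^sub>0 and A = AA and \<alpha> = \<alpha>\<alpha> and q = qq, OF other]
  also note rest_cong(2)[where k\<^sub>0 = k\<^sub>0 and A = AA and \<alpha> = \<alpha>\<alpha> and q = qq, OF other]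
  also note rest_cong(3)[where k\<^sub>0 = k\<^sub>0 and A = AA and \<alpha> = \<alpha>\<alpha> and q = qq, OF other]
  finally show ?thesis
    unfolding AA_k\<^sub>0 .
qed

text \<open>From (sqrt a + sqrt b)^2 \<le> 2 * (a + b), with equality for a = b; the constant of the
  lower bound comes from here.\<close>

lemma sqrt_add_ge:
  fixes a b :: real
  assumes "0 \<le> a" "0 \<le> b"
  shows "1 / sqrt 2 * (sqrt a + sqrt b) \<le> sqrt (a + b)"
proof -
  have "(sqrt a + sqrt b)\<^sup>2 \<le> 2 * (a + b)"
    using assms sum_squares_bound[of "sqrt a" "sqrt b"] by (simp add: power2_sum)
  then have "sqrt a + sqrt b \<le> sqrt (2 * (a + b))"
    by (rule real_le_rsqrt)
  also have "sqrt (2 * (a + b)) = sqrt 2 * sqrt (a + b)"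
    by (rule real_sqrt_mult)
  finally show ?thesis
    by (simp add: pos_divide_le_eq mult.commute)
qed

theorem theorem5:
  fixes M :: "'w measure"
    and A B U :: "(real ^ 'm) set"
    and \<alpha> \<beta> :: "real ^ 'm \<Rightarrow> real"
    and F G H :: "'w \<Rightarrow> real ^ 'm \<Rightarrow> real"
    and As :: "nat \<Rightarrow> (real ^ 'm) set"
    and \<alpha>s :: "nat \<Rightarrow> real ^ 'm \<Rightarrow> real"
    and Fs :: "nat \<Rightarrow> 'w \<Rightarrow> real ^ 'm \<Rightarrow> real"
  assumes "prob_space M"
    and "gaussian_exp_sum M A \<alpha> F"
    and "gaussian_exp_sum M B \<beta> G"
    and "aronszajn_mult M A \<alpha> B \<beta> H"
    and "\<And>i. i \<in> {1..<CARD('m)} \<Longrightarrow> gaussian_exp_sum M (As i) (\<alpha>s i) (Fs i)"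
    and "indep_random_functions M {..<CARD('m)} (adjoin F Fs)"
    and "indep_random_functions M {..<CARD('m)} (adjoin G Fs)"
    and "indep_random_functions M {..<CARD('m)} (adjoin H Fs)"
    and "open U"
  shows "ennreal (1 / sqrt 2) *
           (expected_zeros M {..<CARD('m)} (adjoin F Fs) U + expected_zeros M {..<CARD('m)} (adjoin G Fs) U)
         \<le> expected_zeros M {..<CARD('m)} (adjoin H Fs) U
       \<and> expected_zeros M {..<CARD('m)} (adjoin H Fs) U
         \<le> expected_zeros M {..<CARD('m)} (adjoin F Fs) U + expected_zeros M {..<CARD('m)} (adjoin G Fs) U"
proof -
  define k\<^sub>0 where "k\<^sub>0 = (Abs_ordered_index 0 :: 'm ordered_index)"
  define A' where "A' k = As (Rep_ordered_index k)" for k :: "'m ordered_index"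
  define \<alpha>' where "\<alpha>' k = \<alpha>s (Rep_ordered_index k)" for k :: "'m ordered_index"
  define q where "q k = (SOME a. a \<in> As (Rep_ordered_index k))" for k :: "'m ordered_index"
  define J where "J = Sigma (-{k\<^sub>0}) (\<lambda>k. A' k - {q k})"
  \<comment> \<open>Everything that the three systems share goes into J, g and L, so that each
    expectation becomes \<open>I (f X \<gamma>)\<close> with the distinguished support and
    coefficients as the only varying data.\<close>
  define g where "g \<eta> y = gauss_abs_const * (ennreal (rest_density k\<^sub>0 A' \<alpha>' order_coords q \<eta> y) * indicator (order_coords ` U) y)"
    for \<eta> y
  define L where "L = rest_det k\<^sub>0 A' \<alpha>' order_coords q"
  define v where "v X \<gamma> \<eta> y = exp_var X \<gamma> order_coords y (L \<eta> y)" for X :: "(real ^ 'm) set" and \<gamma> \<eta> y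
  define f where "f X \<gamma> \<eta> y = g \<eta> y * ennreal (sqrt (v X \<gamma> \<eta> y))" for X \<gamma> \<eta> y
  define I where "I h = (\<integral>\<^sup>+\<eta>. \<integral>\<^sup>+y. h \<eta> y \<partial>lborel \<partial>Pi\<^sub>M J (\<lambda>_. std_gauss))"
    for h :: "('m ordered_index \<times> (real ^ 'm) \<Rightarrow> real) \<Rightarrow> real ^ 'm ordered_index \<Rightarrow> ennreal"
  note defs = I_def f_def v_def g_def L_def J_def k\<^sub>0_def A'_def[abs_def] \<alpha>'_def[abs_def] q_def[abs_def]
  have H: "gaussian_exp_sum M (A + B) (aronszajn_coeff A \<alpha> B \<beta>) H"
    using assms(4) by (simp add: aronszajn_mult_def)
  have EF: "expected_zeros M {..<CARD('m)} (adjoin F Fs) U = I (f A \<alpha>)"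
    unfolding defs by (rule expected_zeros_kac_rice[OF assms(1,2,5,6,9)])
  have EG: "expected_zeros M {..<CARD('m)} (adjoin G Fs) U = I (f B \<beta>)"
    unfolding defs by (rule expected_zeros_kac_rice[OF assms(1,3,5,7,9)])
  have EH: "expected_zeros M {..<CARD('m)} (adjoin H Fs) U = I (f (A + B) (aronszajn_coeff A \<alpha> B \<beta>))"
    unfolding defs by (rule expected_zeros_kac_rice[OF assms(1) H assms(5,8,9)])
  have v_add: "v (A + B) (aronszajn_coeff A \<alpha> B \<beta>) \<eta> y = v A \<alpha> \<eta> y + v B \<beta> \<eta> y" for \<eta> y
    unfolding v_def
  proof (rule exp_var_aronszajn)
    show "linear (L \<eta> y)" unfolding L_def by (rule linear_rest_det)
  qed (use assms(2,3) gaussian_exp_sum_nonempty linear_order_coords in \<open>auto simp: gaussian_exp_sum_def\<close>)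
  have v_nonneg: "0 \<le> v X \<gamma> \<eta> y" for X \<gamma> \<eta> y
    unfolding v_def by (rule exp_var_nonneg)
  let ?N = "Pi\<^sub>M J (\<lambda>_. std_gauss) \<Otimes>\<^sub>M (lborel :: (real ^ 'm ordered_index) measure)"
  have comp: "(\<lambda>z. fst z (k, b)) \<in> borel_measurable ?N" if "k \<noteq> k\<^sub>0" "b \<in> A' k - {q k}" for k b
    by (rule borel_measurable_fst_component_std_gauss) (use that in \<open>simp add: J_def\<close>)
  have f_meas: "(\<lambda>z. f X \<gamma> (fst z) (snd z)) \<in> borel_measurable ?N" for X \<gamma>
  proof -
    have snd_meas[measurable]: "snd \<in> borel_measurable ?N" by measurable
    have [measurable]: "(\<lambda>z. rest_density k\<^sub>0 A' \<alpha>' order_coords q (fst z) (snd z)) \<in> borel_measurable ?N"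
      by (rule borel_measurable_rest_density[where c = fst and A = A' and q = q, OF comp snd_meas])
    have "(\<lambda>z. L (fst z) (snd z) w) \<in> borel_measurable ?N" for w
      unfolding L_def by (rule borel_measurable_rest_det[where c = fst and A = A' and q = q, OF comp snd_meas])
    then have [measurable]: "(\<lambda>z. v X \<gamma> (fst z) (snd z)) \<in> borel_measurable ?N"
      unfolding v_def by (rule borel_measurable_exp_var[OF snd_meas])
    have [measurable]: "order_coords ` U \<in> sets borel"
      using open_order_coords_image[OF assms(9)] by simp
    show ?thesis
      unfolding f_def g_def by measurable
  qed
  \<comment> \<open>The inequality holds between integrands, so the two expectations have to be
    merged under one integral; this is where joint measurability of f enters.\<close>
  have I_add: "I h + I h' = I (\<lambda>\<eta> y. h \<eta> y + h' \<eta> y)"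
    and I_cmult: "c * I h = I (\<lambda>\<eta> y. c * h \<eta> y)"
    if h: "(\<lambda>z. h (fst z) (snd z)) \<in> borel_measurable ?N" and h': "(\<lambda>z. h' (fst z) (snd z)) \<in> borel_measurable ?N"
    for h h' c
  proof -
    have inner: "(\<lambda>y. i \<eta> y) \<in> borel_measurable lborel"
      if "(\<lambda>z. i (fst z) (snd z)) \<in> borel_measurable ?N" "\<eta> \<in> space (Pi\<^sub>M J (\<lambda>_. std_gauss))" for i \<eta>
      using measurable_compose[OF measurable_Pair1'[OF that(2)] that(1)] by simp
    have outer: "(\<lambda>\<eta>. \<integral>\<^sup>+y. i \<eta> y \<partial>lborel) \<in> borel_measurable (Pi\<^sub>M J (\<lambda>_. std_gauss))"
      if "(\<lambda>z. i (fst z) (snd z)) \<in> borel_measurable ?N" for i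
      using that by (intro lborel.borel_measurable_nn_integral) (simp add: case_prod_beta)
    show "I h + I h' = I (\<lambda>\<eta> y. h \<eta> y + h' \<eta> y)"
      unfolding I_def nn_integral_add[OF outer[OF h] outer[OF h'], symmetric]
      by (intro nn_integral_cong nn_integral_add[symmetric] inner h h')
    show "c * I h = I (\<lambda>\<eta> y. c * h \<eta> y)"
      unfolding I_def nn_integral_cmult[OF outer[OF h], symmetric]
      by (intro nn_integral_cong nn_integral_cmult[symmetric] inner h)
  qed
  have add: "I (f A \<alpha>) + I (f B \<beta>) = I (\<lambda>\<eta> y. f A \<alpha> \<eta> y + f B \<beta> \<eta> y)"
    by (rule I_add[OF f_meas f_meas])
  have I_mono: "I h \<le> I h'" if "\<And>\<eta> y. h \<eta> y \<le> h' \<eta> y" for h h'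
    unfolding I_def by (intro nn_integral_mono that)
  have sum_eq: "f A \<alpha> \<eta> y + f B \<beta> \<eta> y = g \<eta> y * ennreal (sqrt (v A \<alpha> \<eta> y) + sqrt (v B \<beta> \<eta> y))" for \<eta> y
    unfolding f_def using v_nonneg by (simp add: ennreal_plus distrib_left)
  have "ennreal (1 / sqrt 2) * I (\<lambda>\<eta> y. f A \<alpha> \<eta> y + f B \<beta> \<eta> y) \<le> I (f (A + B) (aronszajn_coeff A \<alpha> B \<beta>))"
  proof -
    \<comment> \<open>The variance for the product is the sum of the two variances, which reduces
      the claim to the inequality for square roots at each \<eta> and y.\<close>
    have "ennreal (1 / sqrt 2) * (f A \<alpha> \<eta> y + f B \<beta> \<eta> y) \<le> f (A + B) (aronszajn_coeff A \<alpha> B \<beta>) \<eta> y" for \<eta> y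
    proof -
      have "ennreal (1 / sqrt 2) * (f A \<alpha> \<eta> y + f B \<beta> \<eta> y) =
          g \<eta> y * ennreal (1 / sqrt 2 * (sqrt (v A \<alpha> \<eta> y) + sqrt (v B \<beta> \<eta> y)))"
        unfolding sum_eq using v_nonneg by (subst ennreal_mult) (simp_all add: mult_ac)
      also have "\<dots> \<le> g \<eta> y * ennreal (sqrt (v A \<alpha> \<eta> y + v B \<beta> \<eta> y))"
        by (intro mult_left_mono ennreal_leI sqrt_add_ge v_nonneg) simp
      finally show ?thesis
        by (simp add: f_def v_add)
    qed
    then have "I (\<lambda>\<eta> y. ennreal (1 / sqrt 2) * (f A \<alpha> \<eta> y + f B \<beta> \<eta> y)) \<le> I (f (A + B) (aronszajn_coeff A \<alpha> B \<beta>))"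
      by (rule I_mono)
    moreover have "(\<lambda>z. f A \<alpha> (fst z) (snd z) + f B \<beta> (fst z) (snd z)) \<in> borel_measurable ?N"
      by (intro borel_measurable_add f_meas)
    ultimately show ?thesis
      by (simp only: I_cmult)
  qed
  moreover have "I (f (A + B) (aronszajn_coeff A \<alpha> B \<beta>)) \<le> I (\<lambda>\<eta> y. f A \<alpha> \<eta> y + f B \<beta> \<eta> y)"
  proof (rule I_mono)
    fix \<eta> y
    show "f (A + B) (aronszajn_coeff A \<alpha> B \<beta>) \<eta> y \<le> f A \<alpha> \<eta> y + f B \<beta> \<eta> y"
      unfolding sum_eq unfolding f_def v_add
      by (intro mult_left_mono ennreal_leI sqrt_add_le_add_sqrt v_nonneg) simp
  qed
  ultimately show ?thesis
    unfolding EF EG EH add by blast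
qed

end
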